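(* Let $n\ge2$, $\nu>2$, $d=n(n-1)/2$, and let $Z\sim t^{\mathrm{std}}_{\nu}(0,C)$ on $\mathbb R^n$ where $C$ is a nonsingular correlation matrix parametrized by $\gamma=\mathrm{vecl}(\log C)\in\mathbb R^d$. Let $\ell(Z)$ be the log-density of $Z$, viewed as a function of $\gamma$, let $\nabla=\partial\ell(Z)/\partial\gamma$ be the score and $\mathcal I=\mathbb E[\nabla\nabla']$ the information matrix. Then $$\nabla=\tfrac12 M'C_\otimes^{-1}\big[W\,\mathrm{vec}(ZZ')-\mathrm{vec}(C)\big],\qquad \mathcal I=\tfrac14M'\big[\phi\,C_\otimes^{-1}H_n+(\phi-1)\mathrm{vec}(C^{-1})\mathrm{vec}(C^{-1})'\big]M,$$ where $H_n=I_{n^2}+K_n$, $$W=\frac{\nu+n}{\nu-2+Z'C^{-1}Z},\qquad \phi=\frac{\nu+n}{\nu+n+2},$$ and $$M=\frac{\partial\mathrm{vec}(C)}{\partial\gamma'}=(E_l+E_u)'E_l\big(I_{n^2}-\Gamma E_d'(E_d\Gamma E_d')^{-1}E_d\big)\Gamma(E_l+E_u)',$$ with $\Gamma=\partial\mathrm{vec}(C)/\partial\mathrm{vec}(\log C)'$ given as follows: writing $\log C=Q\,\mathrm{diag}(\lambda_1,\ldots,\lambda_n)Q'$ with $Q$ orthonormal, $\Gamma=(Q\otimes Q)\Xi(Q\otimes Q)'$ where $\Xi$ is the $n^2\times n^2$ diagonal matrix with $(i-1)n+j$-th diagonal entry $\delta_{ij}=e^{\lambda_i}$ if $\lambda_i=\lambda_j$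 and $\delta_{ij}=(e^{\lambda_i}-e^{\lambda_j})/(\lambda_i-\lambda_j)$ otherwise.
   Context: $\log C$ is the matrix logarithm of the (symmetric positive definite) correlation matrix $C$; $\mathrm{vecl}(B)$ stacks the strictly-below-diagonal elements of $B$ column by column, and $\gamma\mapsto C$ is a bijection between $\mathbb R^d$ and the nonsingular $n\times n$ correlation matrices. For $\nu>2$ and positive definite $\Sigma$, $t^{\mathrm{std}}_\nu(0,\Sigma)$ on $\mathbb R^n$ has density $\frac{\Gamma((\nu+n)/2)}{\Gamma(\nu/2)}[(\nu-2)\pi]^{-n/2}|\Sigma|^{-1/2}[1+\tfrac1{\nu-2}y'\Sigma^{-1}y]^{-(\nu+n)/2}$. Notation: $B_\otimes=B\otimes B$ (so $C_\otimes^{-1}=C^{-1}\otimes C^{-1}$); $K_n$ is the $n^2\times n^2$ commutation matrix ($K_n\mathrm{vec}(B)=\mathrm{vec}(B')$); $E_l,E_u$ are the $d\times n^2$ elimination matrices with $E_l\mathrm{vec}(B)=\mathrm{vecl}(B)$, $E_u\mathrm{vec}(B)=\mathrm{vecl}(B')$; $E_d$ is the $n\times n^2$ matrix with $E_d\mathrm{vec}(B)=\mathrm{diag}(B)$. *)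

theory Defs
  imports "HOL-Analysis.Analysis"
begin

primrec mpow :: "real^'n^'n \<Rightarrow> nat \<Rightarrow> real^'n^'n" where
  "mpow A 0 = mat 1"
| "mpow A (Suc k) = A ** mpow A k"

definition mexp :: "real^'n^'n \<Rightarrow> real^'n^'n" where
  "mexp A = (\<Sum>k. (1 / fact k) *\<^sub>R mpow A k)"

text \<open>Matrix logarithm of a symmetric positive definite matrix: the unique symmetric real logarithm.\<close>
definition mlog :: "real^'n^'n \<Rightarrow> real^'n^'n" where
  "mlog C = (THE A. transpose A = A \<and> mexp A = C)"

definition is_ns_corr :: "real^'n^'n \<Rightarrow> bool" where
  "is_ns_corr C \<longleftrightarrow> transpose C = C \<and> (\<forall>i. C $ i $ i = 1)
     \<and> (\<forall>x. x \<noteq> 0 \<longrightarrow> x \<bullet> (C *v x) > 0)"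

text \<open>vec: the entry in row i, column j sits at index (i,j); the numbering used in the paper
  (column-major, position (j-1)n+i) is only a labelling of these indices.\<close>
definition vecm :: "real^'n^'n \<Rightarrow> real^('n \<times> 'n)" where
  "vecm B = (\<chi> ij. B $ fst ij $ snd ij)"

text \<open>Kronecker product, compatible with vecm: kron P R *v vecm X = vecm (R ** X ** transpose P).\<close>
definition kron :: "real^'n^'n \<Rightarrow> real^'n^'n \<Rightarrow> real^('n \<times> 'n)^('n \<times> 'n)" where
  "kron P R = (\<chi> ij kl. P $ snd ij $ snd kl * R $ fst ij $ fst kl)"

text \<open>Commutation matrix K_n: K_n vec(B) = vec(B').\<close>
definition commat :: "real^('n::finite \<times> 'n)^('n \<times> 'n)" where
  "commat = (\<chi> ij kl. if kl = (snd ij, fst ij) then 1 else 0)"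

text \<open>E_d: E_d vec(B) = diag(B).\<close>
definition Ed :: "real^('n::finite \<times> 'n)^'n" where
  "Ed = (\<chi> m kl. if kl = (m, m) then 1 else 0)"

text \<open>The index map of vecl: p :: 'd \<Rightarrow> 'n \<times> 'n sends the k-th position of vecl to (row, column)
  of a strictly-below-diagonal entry; stacking column by column.\<close>
definition colmaj_less :: "('n::linorder \<times> 'n) \<Rightarrow> ('n \<times> 'n) \<Rightarrow> bool" where
  "colmaj_less a b \<longleftrightarrow> snd a < snd b \<or> (snd a = snd b \<and> fst a < fst b)"

definition vecl_index :: "('d::{finite,linorder} \<Rightarrow> ('n::{finite,linorder} \<times> 'n)) \<Rightarrow> bool" where
  "vecl_index p \<longleftrightarrow> bij_betw p UNIV {(i,j). j < i}
     \<and> (\<forall>k l. k < l \<longleftrightarrow> colmaj_less (p k) (p l))"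

definition vecl :: "('d::finite \<Rightarrow> 'n::finite \<times> 'n) \<Rightarrow> real^'n^'n \<Rightarrow> real^'d" where
  "vecl p B = (\<chi> k. B $ fst (p k) $ snd (p k))"

text \<open>E_l vec(B) = vecl(B),  E_u vec(B) = vecl(B').\<close>
definition El :: "('d::finite \<Rightarrow> 'n::finite \<times> 'n) \<Rightarrow> real^('n \<times> 'n)^'d" where
  "El p = (\<chi> k ab. if ab = p k then 1 else 0)"

definition Eu :: "('d::finite \<Rightarrow> 'n::finite \<times> 'n) \<Rightarrow> real^('n \<times> 'n)^'d" where
  "Eu p = (\<chi> k ab. if (snd ab, fst ab) = p k then 1 else 0)"

definition corr_of :: "('d::finite \<Rightarrow> 'n::finite \<times> 'n) \<Rightarrow> real^'d \<Rightarrow> real^'n^'n" where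
  "corr_of p \<gamma> = (THE C. is_ns_corr C \<and> vecl p (mlog C) = \<gamma>)"

definition mdiag :: "real^'n \<Rightarrow> real^'n^'n" where
  "mdiag v = (\<chi> i j. if i = j then v $ i else 0)"

definition outer :: "real^'a \<Rightarrow> real^'b \<Rightarrow> real^'b^'a" where
  "outer u v = (\<chi> i j. u $ i * v $ j)"

definition dk_delta :: "real \<Rightarrow> real \<Rightarrow> real" where
  "dk_delta a b = (if a = b then exp a else (exp a - exp b) / (a - b))"

definition Xi :: "real^'n \<Rightarrow> real^('n \<times> 'n)^('n \<times> 'n)" where
  "Xi lam = (\<chi> ij kl. if ij = kl then dk_delta (lam $ fst ij) (lam $ snd ij) else 0)"

definition tstd_density :: "real \<Rightarrow> real^'n^'n \<Rightarrow> real^'n \<Rightarrow> real" where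
  "tstd_density \<nu> \<Sigma> y =
     Gamma ((\<nu> + real CARD('n)) / 2) / Gamma (\<nu> / 2)
     * ((\<nu> - 2) * pi) powr (- real CARD('n) / 2)
     * det \<Sigma> powr (-1/2)
     * (1 + (1 / (\<nu> - 2)) * (y \<bullet> (matrix_inv \<Sigma> *v y))) powr (- (\<nu> + real CARD('n)) / 2)"

end

theory Submission
  imports Defs "HOL-Probability.Distributions"
begin

text \<open>
  Let \<open>A = log C\<close>. The trace of \<open>mexp\<close> is strictly convex on symmetric matrices, because its
  Daleckii--Krein derivative is diagonal with positive entries in an eigenbasis of \<open>A\<close>. Hence for fixed
  off-diagonal entries of \<open>A\<close> exactly one diagonal makes the diagonal of \<open>mexp A\<close> equal to 1 (it
  minimises \<open>tr (mexp A) - tr A\<close>), and the inverse function theorem for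
  \<open>(off-diagonal, diagonal) \<mapsto> (off-diagonal, diag (mexp A))\<close> yields the Jacobian \<open>M\<close>. The score
  follows from \<open>ln det C = tr A\<close> and \<open>C\<inverse> = mexp (- A)\<close>. For the information matrix, substitute
  \<open>z = \<surd>(\<nu> - 2) C\<^sup>1\<^sup>/\<^sup>2 u\<close>, which turns the score into a linear image of
  \<open>2s u u' / (1 + |u|\<^sup>2) - I\<close> with \<open>2s = \<nu> + n\<close>. Its second moments under the spherical density
  are obtained by writing that density as a Gamma mixture of Gaussians and, for odd monomials, by reflection.
\<close>

section \<open>Diagonalization of symmetric matrices\<close>

text \<open>Eigenvectors need not depend differentiably on a matrix where eigenvalues collide. So
  \<open>mexp\<close> is differentiated through its power series, and the resulting derivative is
  evaluated in an eigenbasis frozen at the base point.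

  The diagonal of log C is only implicitly determined by \<gamma>. Strict monotonicity of
  \<open>mexp\<close> supplies both the global injectivity that lets one use an inverse function
  theorem with differentiability at a single point, and the positivity that makes the linearised
  diagonal equation solvable.

  In the information matrix each factor W divides by \<open>1 + u \<bullet> u\<close>, so a monomial
  of degree 2m meets the exponent s + m. All moments then converge as soon as s > n/2, and they
  share the factor Gamma (s - n/2). The constant \<phi> = s/(s+1) is the prefactor (2s)^2 of the
  quartic term times Gamma s / Gamma (s+2) = 1/(s(s+1)) and the Gaussian weight 1/4.\<close>

lemma inner_matrix_mult_left:
  fixes A :: "real^'m^'k" and X :: "real^'n^'m" and Y :: "real^'n^'k"
  shows "(A ** X) \<bullet> Y = X \<bullet> (transpose A ** Y)"
proof -
  have "(A ** X) \<bullet> Y = (\<Sum>i\<in>UNIV. \<Sum>j\<in>UNIV. \<Sum>k\<in>UNIV. A $ i $ k * X $ k $ j * Y $ i $ j)"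
    by (simp add: inner_vec_def matrix_matrix_mult_def sum_distrib_right)
  also have "\<dots> = (\<Sum>k\<in>UNIV. \<Sum>j\<in>UNIV. \<Sum>i\<in>UNIV. A $ i $ k * X $ k $ j * Y $ i $ j)"
    by (subst sum.swap, subst sum.swap[where A=UNIV and B=UNIV], rule sum.cong, rule refl, rule sum.swap)
  also have "\<dots> = X \<bullet> (transpose A ** Y)"
    by (simp add: inner_vec_def matrix_matrix_mult_def transpose_def sum_distrib_left mult_ac)
  finally show ?thesis .
qed

lemma inner_transpose:
  fixes X Y :: "real^'n^'m"
  shows "transpose X \<bullet> transpose Y = X \<bullet> Y"
  unfolding inner_vec_def transpose_def by (simp, rule sum.swap)

lemma inner_matrix_mult_right:
  fixes A :: "real^'n^'m" and X :: "real^'m^'k" and Y :: "real^'n^'k"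
  shows "(X ** A) \<bullet> Y = X \<bullet> (Y ** transpose A)"
proof -
  have "(X ** A) \<bullet> Y = (transpose A ** transpose X) \<bullet> transpose Y"
    using inner_transpose[of "X ** A" Y] by (simp add: matrix_transpose_mul)
  also have "\<dots> = transpose X \<bullet> transpose (Y ** transpose A)"
    by (simp add: inner_matrix_mult_left matrix_transpose_mul)
  finally show ?thesis by (simp add: inner_transpose)
qed

lemma symmetric_matrix_inner:
  fixes A :: "real^'n^'n"
  assumes "transpose A = A"
  shows "(A *v x) \<bullet> y = x \<bullet> (A *v y)"
  using assms dot_lmul_matrix[of x A y] by (metis transpose_matrix_vector)

text \<open>The maximiser x of the Rayleigh quotient on the unit sphere of S is an eigenvector: the
  first variation makes the residual \<open>\<mu> *\<^sub>R x - A *v x\<close> orthogonal to S, and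
  invariance puts it in S.\<close>

lemma symmetric_matrix_eigenvector_in_subspace:
  fixes A :: "real^'n^'n"
  assumes A: "transpose A = A" and S: "subspace S" "S \<noteq> {0}"
    and inv: "\<And>x. x \<in> S \<Longrightarrow> A *v x \<in> S"
  obtains x \<mu> where "x \<in> S" "norm x = 1" "A *v x = \<mu> *\<^sub>R x"
proof -
  let ?K = "sphere 0 1 \<inter> S"
  let ?q = "\<lambda>x. x \<bullet> (A *v x)"
  have comp: "compact ?K"
    by (intro compact_Int_closed compact_sphere closed_subspace S)
  obtain w where w: "w \<in> S" "w \<noteq> 0"
    using S subspace_0 by blast
  have "(1 / norm w) *\<^sub>R w \<in> ?K"
    using w S by (simp add: subspace_scale)
  then have ne: "?K \<noteq> {}" by blast
  have "continuous_on ?K ?q"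
    by (intro continuous_intros linear_continuous_on_compose[OF _ matrix_vector_mul_linear] continuous_on_id)
  then obtain x where x: "x \<in> ?K" and xmax: "\<And>y. y \<in> ?K \<Longrightarrow> ?q y \<le> ?q x"
    using continuous_attains_sup[OF comp ne] by blast
  define \<mu> where "\<mu> = ?q x"
  have xx: "x \<bullet> x = 1" "x \<in> S"
    using x by (auto simp: norm_eq_1)
  have bound: "?q y \<le> \<mu> * (y \<bullet> y)" if "y \<in> S" for y
  proof (cases "y = 0")
    case False
    then have "(1 / norm y) *\<^sub>R y \<in> ?K"
      using that S by (simp add: subspace_scale)
    from xmax[OF this] have "?q y / (norm y * norm y) \<le> \<mu>"
      by (simp add: \<mu>_def matrix_vector_mult_scaleR)
    then show ?thesis
      using False by (simp add: dot_square_norm power2_eq_square field_simps)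
  qed simp
  have lin: "y \<bullet> (\<mu> *\<^sub>R x - A *v x) = 0" if y: "y \<in> S" for y
  proof (rule ccontr)
    define b where "b = y \<bullet> (\<mu> *\<^sub>R x - A *v x)"
    define c where "c = \<mu> * (y \<bullet> y) - ?q y"
    assume "\<not> ?thesis"
    then have b: "b \<noteq> 0" by (simp add: b_def)
    have c: "c \<ge> 0" using bound[OF y] by (simp add: c_def)
    \<comment> \<open>The bound at \<open>x + t *\<^sub>R y\<close>; its term of order zero in t
      vanishes because x attains the maximum.\<close>
    have quad: "0 \<le> 2 * t * b + t\<^sup>2 * c" for t
    proof -
      have "x + t *\<^sub>R y \<in> S" using y xx S by (simp add: subspace_add subspace_scale)
      from bound[OF this] show ?thesis
        using symmetric_matrix_inner[OF A, of x y] xx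
        by (simp add: b_def c_def matrix_vector_right_distrib matrix_vector_mult_scaleR
            inner_simps algebra_simps power2_eq_square \<mu>_def inner_commute)
    qed
    \<comment> \<open>Dividing by c + 1 keeps the step size defined when c = 0. At t = -s the
      quadratic equals -s^2 (c + 2), which is negative.\<close>
    define s where "s = b / (c + 1)"
    have bs: "b = s * (c + 1)" using c by (simp add: s_def)
    then have "s \<noteq> 0" using b by auto
    have "0 \<le> 2 * (- s) * b + (- s)\<^sup>2 * c"
      by (rule quad)
    also have "\<dots> = - (s\<^sup>2 * (c + 2))"
      by (simp add: bs algebra_simps power2_eq_square)
    also have "\<dots> < 0"
      using \<open>s \<noteq> 0\<close> c by simp
    finally show False by simp
  qed
  have "\<mu> *\<^sub>R x - A *v x \<in> S"
    using xx inv S by (simp add: subspace_diff subspace_scale)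
  from lin[OF this] have "A *v x = \<mu> *\<^sub>R x" by simp
  then show ?thesis using that x by auto
qed

text \<open>The induction has to range over invariant subspaces: symmetry moves A onto the
  eigenvector x just found, so the orthogonal complement of x within S is again invariant and has
  one dimension less.\<close>

lemma symmetric_matrix_eigenbasis_of_subspace:
  fixes A :: "real^'n^'n"
  assumes A: "transpose A = A"
  shows "subspace S \<Longrightarrow> (\<And>x. x \<in> S \<Longrightarrow> A *v x \<in> S) \<Longrightarrow>
    \<exists>B \<subseteq> S. finite B \<and> pairwise orthogonal B \<and> card B = dim S \<and>
      (\<forall>x\<in>B. norm x = 1 \<and> (\<exists>\<mu>. A *v x = \<mu> *\<^sub>R x))"
proof (induction "dim S" arbitrary: S)
  case 0
  then show ?case by (intro exI[of _ "{}"]) (auto simp: pairwise_def)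
next
  case (Suc k)
  have "S \<noteq> {0}" using Suc.hyps(2) by auto
  then obtain x \<mu> where x: "x \<in> S" "norm x = 1" "A *v x = \<mu> *\<^sub>R x"
    using symmetric_matrix_eigenvector_in_subspace[OF A Suc.prems(1) _ Suc.prems(2)] by blast
  define T where "T = {y \<in> S. \<forall>u\<in>span {x}. orthogonal u y}"
  have T: "y \<in> T \<longleftrightarrow> y \<in> S \<and> x \<bullet> y = 0" for y
    by (auto simp: T_def orthogonal_def span_singleton)
  have x0: "x \<noteq> 0" using x(2) by auto
  have "dim T + dim (span {x}) = dim S"
    unfolding T_def
    by (intro dim_subspace_orthogonal_to_vectors subspace_span Suc.prems span_minimal) (use x in auto)
  then have "dim T = k"
    using Suc.hyps(2) x0 by (simp add: dim_singleton)
  moreover have "subspace T"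
    unfolding subspace_def using Suc.prems(1)
    by (auto simp: T subspace_0 subspace_add subspace_scale inner_simps)
  moreover have "A *v y \<in> T" if "y \<in> T" for y
    using that Suc.prems(2) symmetric_matrix_inner[OF A, of x y] x(3) by (auto simp: T)
  ultimately obtain B where B: "B \<subseteq> T" "finite B" "pairwise orthogonal B" "card B = k"
      "\<forall>x\<in>B. norm x = 1 \<and> (\<exists>\<mu>. A *v x = \<mu> *\<^sub>R x)"
    using Suc.hyps(1)[of T] by auto
  have "x \<notin> B" using B(1) x0 by (auto simp: T)
  then have "card (insert x B) = dim S" using B(2,4) Suc.hyps(2) by simp
  moreover have "pairwise orthogonal (insert x B)"
    using B(1,3) by (auto simp: pairwise_insert orthogonal_def T inner_commute)
  ultimately show ?case
    using B x by (intro exI[of _ "insert x B"]) (auto simp: T)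
qed

theorem symmetric_matrix_diagonalization:
  fixes A :: "real^'n^'n"
  assumes A: "transpose A = A"
  obtains Q lam where "orthogonal_matrix Q" "A = Q ** mdiag lam ** transpose Q"
proof -
  obtain B where B: "finite B" "pairwise orthogonal B" "card B = CARD('n)"
      "\<forall>x\<in>B. norm x = 1 \<and> (\<exists>\<mu>. A *v x = \<mu> *\<^sub>R x)"
    using symmetric_matrix_eigenbasis_of_subspace[OF A, of UNIV] by auto
  then obtain f where f: "bij_betw f (UNIV :: 'n set) B"
    using finite_same_card_bij[of "UNIV :: 'n set" B] by auto
  have fB: "f i \<in> B" for i using f by (auto simp: bij_betw_def)
  then have "\<forall>i. \<exists>\<mu>. A *v f i = \<mu> *\<^sub>R f i"
    using B(4) by blast
  then obtain m where m: "\<And>i. A *v f i = m i *\<^sub>R f i"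
    by metis
  define Q where "Q = (\<chi> i j. f j $ i)"
  define lam where "lam = vec_lambda m"
  have "orthogonal (f i) (f j)" if "i \<noteq> j" for i j
    using B(2) fB that f unfolding pairwise_def bij_betw_def inj_on_def by blast
  then have Q: "orthogonal_matrix Q"
    using B(4) fB by (simp add: Q_def orthogonal_matrix_orthonormal_columns column_def)
  have "A ** Q = Q ** mdiag lam"
  proof -
    have "(A ** Q) $ i $ j = (Q ** mdiag lam) $ i $ j" for i j
    proof -
      have "(A ** Q) $ i $ j = (A *v f j) $ i"
        by (simp add: matrix_matrix_mult_def matrix_vector_mult_def Q_def)
      also have "\<dots> = (Q ** mdiag lam) $ i $ j"
        by (simp add: m matrix_matrix_mult_def mdiag_def Q_def lam_def if_distrib cong: if_cong)
      finally show ?thesis .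
    qed
    then show ?thesis by (simp add: vec_eq_iff)
  qed
  then have "A ** (Q ** transpose Q) = Q ** mdiag lam ** transpose Q"
    by (simp add: matrix_mul_assoc)
  then have "A = Q ** mdiag lam ** transpose Q"
    using Q by (simp add: orthogonal_matrix_def)
  with Q show ?thesis using that by blast
qed

section \<open>The derivative of the matrix exponential\<close>

lemma bounded_bilinear_matrix_mult:
  "bounded_bilinear ((**) :: real^'n^'m \<Rightarrow> real^'k^'n \<Rightarrow> real^'k^'m)"
  unfolding bilinear_conv_bounded_bilinear[symmetric] bilinear_def
  by (auto intro!: linearI simp: matrix_matrix_mult_def vec_eq_iff sum.distrib sum_distrib_left algebra_simps)

interpretation matrix_mult: bounded_bilinear "(**) :: real^'n^'m \<Rightarrow> real^'k^'n \<Rightarrow> real^'k^'m"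
  by (rule bounded_bilinear_matrix_mult)

lemma bounded_linear_matrix_sandwich:
  "bounded_linear (\<lambda>X. (P :: real^'n^'m) ** X ** (R :: real^'l^'k))"
  by (rule bounded_linear_compose[OF matrix_mult.bounded_linear_left matrix_mult.bounded_linear_right])

text \<open>Since A and H need not commute, this is the sum of A^i H A^(k-1-i) over i < k, arranged
  to follow the recursion of \<open>mpow\<close>.\<close>

primrec mpow_deriv :: "real^'n^'n \<Rightarrow> nat \<Rightarrow> real^'n^'n \<Rightarrow> real^'n^'n" where
  "mpow_deriv A 0 H = 0"
| "mpow_deriv A (Suc k) H = A ** mpow_deriv A k H + H ** mpow A k"

lemma has_derivative_mpow:
  "((\<lambda>A. mpow A k) has_derivative mpow_deriv A k) (at A within S)"
proof (induction k)
  case 0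
  then show ?case by (simp add: fun_eq_iff)
next
  case (Suc k)
  show ?case
    using matrix_mult.FDERIV[OF has_derivative_ident Suc]
    by (simp add: fun_eq_iff)
qed

text \<open>K comes from the boundedness of matrix multiplication as a bilinear map and N from the
  norm of the identity. Growth of this type is enough, because division by \<open>fact k\<close>
  makes it summable. The truncated exponent \<open>k - 1\<close> at k = 0 is harmless next to the
  factor \<open>real k\<close>.\<close>

lemma mpow_norm_bounds:
  obtains K N :: real where "K > 0" "N > 0"
    "\<And>(A::real^'n^'n) k. norm (mpow A k) \<le> N * (K * norm A) ^ k"
    "\<And>(A::real^'n^'n) k H. norm (mpow_deriv A k H) \<le> real k * (N * K * (K * norm A) ^ (k - 1)) * norm H"
proof -
  obtain K where K: "K > 0" and mult: "\<And>(A :: real^'n^'n) (B :: real^'n^'n). norm (A ** B) \<le> norm A * norm B * K"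
    using matrix_mult.pos_bounded by blast
  define N where "N = norm (mat 1 :: real^'n^'n) + 1"
  have N: "N > 0" by (simp add: N_def add_nonneg_pos)
  have pw: "norm (mpow A k) \<le> N * (K * norm A) ^ k" for A :: "real^'n^'n" and k
  proof (induction k)
    case (Suc k)
    have "norm (mpow A (Suc k)) \<le> norm A * norm (mpow A k) * K"
      using mult[of A "mpow A k"] by simp
    also have "\<dots> \<le> norm A * (N * (K * norm A) ^ k) * K"
      using Suc K by (intro mult_right_mono mult_left_mono) auto
    finally show ?case by (simp add: mult_ac)
  qed (simp add: N_def)
  have "norm (mpow_deriv A k H) \<le> real k * (N * K * (K * norm A) ^ (k - 1)) * norm H"
    for A H :: "real^'n^'n" and k
  proof (induction k)
    case (Suc k)
    have 1: "norm (H ** mpow A k) \<le> N * K * (K * norm A) ^ k * norm H"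
    proof -
      have "norm (H ** mpow A k) \<le> norm H * norm (mpow A k) * K"
        by (rule mult)
      also have "\<dots> \<le> norm H * (N * (K * norm A) ^ k) * K"
        using pw K by (intro mult_right_mono mult_left_mono) auto
      finally show ?thesis by (simp add: mult_ac)
    qed
    have 2: "norm (A ** mpow_deriv A k H) \<le> real k * (N * K * (K * norm A) ^ k) * norm H"
    proof -
      have "norm (A ** mpow_deriv A k H) \<le> norm A * norm (mpow_deriv A k H) * K"
        by (rule mult)
      also have "\<dots> \<le> norm A * (real k * (N * K * (K * norm A) ^ (k - 1)) * norm H) * K"
        using Suc K by (intro mult_right_mono mult_left_mono) auto
      also have "\<dots> = real k * (N * K * (K * norm A) ^ k) * norm H"
        by (cases k) (auto simp: mult_ac)
      finally show ?thesis .
    qed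
    have "norm (mpow_deriv A (Suc k) H) \<le> norm (A ** mpow_deriv A k H) + norm (H ** mpow A k)"
      by (simp add: norm_triangle_ineq)
    also have "\<dots> \<le> real (Suc k) * (N * K * (K * norm A) ^ (Suc k - 1)) * norm H"
      using 1 2 by (simp add: algebra_simps)
    finally show ?case .
  qed simp
  with K N pw show ?thesis using that by blast
qed

lemma mexp_sums: "(\<lambda>k. (1 / fact k) *\<^sub>R mpow A k) sums mexp A"
proof -
  obtain K N :: real where "\<And>k. norm (mpow A k) \<le> N * (K * norm A) ^ k"
    using mpow_norm_bounds by metis
  then have "norm ((1 / fact k) *\<^sub>R mpow A k) \<le> N * (inverse (fact k) * (K * norm A) ^ k)" for k
    by (simp add: field_simps divide_right_mono)
  then have "summable (\<lambda>k. (1 / fact k) *\<^sub>R mpow A k)"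
    by (intro summable_comparison_test'[OF summable_mult[OF summable_exp]])
  then show ?thesis
    unfolding mexp_def by (rule summable_sums)
qed

lemma has_derivative_mexp_series:
  fixes A :: "real^'n^'n"
  shows "(mexp has_derivative (\<lambda>H. \<Sum>k. (1 / fact k) *\<^sub>R mpow_deriv A k H)) (at A)"
proof -
  obtain K N :: real where KN: "K > 0" "N > 0" and
    bd: "\<And>(A::real^'n^'n) k H. norm (mpow_deriv A k H) \<le> real k * (N * K * (K * norm A) ^ (k - 1)) * norm H"
    using mpow_norm_bounds by metis
  \<comment> \<open>A ball around 0 that contains A: on it a single summable majorant b serves all
    points X.\<close>
  define R where "R = norm A + 1"
  define b where "b k = real k * (N * K * (K * R) ^ (k - 1)) / fact k" for k :: nat
  have "summable (\<lambda>k. N * K * (inverse (fact k) * (K * R) ^ k))"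
    by (intro summable_mult summable_exp)
  also have "(\<lambda>k. N * K * (inverse (fact k) * (K * R) ^ k)) = (\<lambda>k. b (Suc k))"
    by (auto simp: b_def fun_eq_iff field_simps simp del: of_nat_Suc)
  finally have b: "summable b" by (simp only: summable_Suc_iff)
  define f' where "f' k X H = (1 / fact k) *\<^sub>R mpow_deriv X k H" for k and X H :: "real^'n^'n"
  have f'b: "norm (f' k X H) \<le> b k * norm H" if "X \<in> ball 0 R" for k and X H :: "real^'n^'n"
  proof -
    have "norm (f' k X H) \<le> (1 / fact k) * (real k * (N * K * (K * norm X) ^ (k - 1)) * norm H)"
      using bd[of X k H] by (simp add: f'_def divide_right_mono)
    also have "\<dots> \<le> (1 / fact k) * (real k * (N * K * (K * R) ^ (k - 1)) * norm H)"
      using that KN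
      by (intro mult_left_mono mult_right_mono power_mono) auto
    finally show ?thesis by (simp add: b_def)
  qed
  have sm: "summable (\<lambda>k. f' k X H)" if "X \<in> ball 0 R" for X H :: "real^'n^'n"
    using f'b[OF that] by (intro summable_comparison_test'[OF summable_mult2[OF b]])
  have "\<exists>g. \<forall>X\<in>ball (0::real^'n^'n) R. (\<lambda>k. (1 / fact k) *\<^sub>R mpow X k) sums g X \<and>
          (g has_derivative (\<lambda>H. \<Sum>k. f' k X H)) (at X within ball 0 R)"
  proof (rule has_derivative_series)
    show "((\<lambda>X. (1 / fact k) *\<^sub>R mpow X k) has_derivative f' k X) (at X within ball 0 R)" for k and X :: "real^'n^'n"
      unfolding f'_def by (intro derivative_intros has_derivative_mpow)
    show "A \<in> ball 0 R" by (simp add: R_def)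
    show "(\<lambda>k. (1 / fact k) *\<^sub>R mpow A k) sums mexp A" by (rule mexp_sums)
    fix e :: real assume e: "e > 0"
    \<comment> \<open>The tail of the majorant bounds the error of the partial derivatives uniformly
      in X, relative to \<open>norm H\<close>, as termwise differentiation requires.\<close>
    obtain n0 where n0: "\<And>n. n \<ge> n0 \<Longrightarrow> norm (\<Sum>i. b (i + n)) < e"
      using suminf_exist_split[OF e b] by blast
    show "\<forall>\<^sub>F n in sequentially. \<forall>X\<in>ball 0 R. \<forall>H.
        norm ((\<Sum>i<n. f' i X H) - (\<Sum>k. f' k X H)) \<le> e * norm H"
      unfolding eventually_sequentially
    proof (intro exI allI impI ballI)
      fix n and X H :: "real^'n^'n" assume n: "n0 \<le> n" and X: "X \<in> ball 0 R"
      have sbn: "summable (\<lambda>i. b (i + n))" using b by (simp add: summable_iff_shift)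
      have "(\<Sum>k. f' k X H) = (\<Sum>i. f' (i + n) X H) + (\<Sum>i<n. f' i X H)"
        by (rule suminf_split_initial_segment[OF sm[OF X]])
      then have "norm ((\<Sum>i<n. f' i X H) - (\<Sum>k. f' k X H)) = norm (\<Sum>i. f' (i + n) X H)"
        by simp
      also have "\<dots> \<le> (\<Sum>i. b (i + n) * norm H)"
        by (intro norm_suminf_le f'b X summable_mult2 sbn)
      also have "\<dots> = (\<Sum>i. b (i + n)) * norm H"
        by (rule suminf_mult2[OF sbn, symmetric])
      also have "\<dots> \<le> e * norm H"
        using n0[OF n] by (intro mult_right_mono) auto
      finally show "norm ((\<Sum>i<n. f' i X H) - (\<Sum>k. f' k X H)) \<le> e * norm H" .
    qed
  qed simp
  then obtain g where g: "\<And>X. X \<in> ball 0 R \<Longrightarrow> (\<lambda>k. (1 / fact k) *\<^sub>R mpow X k) sums g X"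
      "\<And>X. X \<in> ball 0 R \<Longrightarrow> (g has_derivative (\<lambda>H. \<Sum>k. f' k X H)) (at X within ball 0 R)"
    by blast
  have A: "A \<in> ball 0 R" by (simp add: R_def)
  have gX: "g X = mexp X" if "X \<in> ball 0 R" for X :: "real^'n^'n"
    by (rule sums_unique2[OF g(1)[OF that] mexp_sums])
  have "(g has_derivative (\<lambda>H. \<Sum>k. f' k A H)) (at A)"
    using g(2)[OF A] at_within_open[OF A open_ball] by simp
  then have "(mexp has_derivative (\<lambda>H. \<Sum>k. f' k A H)) (at A)"
    by (rule has_derivative_transform_within_open[OF _ open_ball A gX])
  then show ?thesis by (simp add: f'_def)
qed

section \<open>Divided differences and the Daleckii-Krein formula\<close>

definition hadamard :: "real^'n^'m \<Rightarrow> real^'n^'m \<Rightarrow> real^'n^'m" where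
  "hadamard G X = (\<chi> i j. G $ i $ j * X $ i $ j)"

lemma hadamard_nth [simp]: "hadamard G X $ i $ j = G $ i $ j * X $ i $ j"
  by (simp add: hadamard_def)

text \<open>The Daleckii--Krein formula for the derivative of the matrix exponential at
  \<open>Q diag(lam) Q'\<close>.\<close>
definition dexp :: "real^'n^'n \<Rightarrow> real^'n \<Rightarrow> real^'n^'n \<Rightarrow> real^'n^'n" where
  "dexp Q lam H = Q ** hadamard (\<chi> i j. dk_delta (lam $ i) (lam $ j)) (transpose Q ** H ** Q) ** transpose Q"

lemma mdiag_nth [simp]: "mdiag v $ i $ j = (if i = j then v $ i else 0)"
  by (simp add: mdiag_def)

lemma mdiag_mult_nth [simp]: "(mdiag v ** X) $ i $ j = v $ i * X $ i $ j"
  by (simp add: matrix_matrix_mult_def if_distrib if_distribR cong: if_cong)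

lemma mult_mdiag_nth [simp]: "(X ** mdiag v) $ i $ j = X $ i $ j * v $ j"
  by (simp add: matrix_matrix_mult_def if_distrib cong: if_cong)

lemma orthogonal_matrix_cancel:
  assumes "orthogonal_matrix (Q :: real^'n^'n)"
  shows "X ** Q ** transpose Q = X" "X ** transpose Q ** Q = X"
  using assms by (metis matrix_mul_assoc matrix_mul_rid orthogonal_matrix_def)+

lemma mpow_diagonalized:
  assumes Q: "orthogonal_matrix Q"
  shows "mpow (Q ** mdiag lam ** transpose Q) k = Q ** mdiag (\<chi> i. lam $ i ^ k) ** transpose Q"
proof (induction k)
  case 0
  have "mdiag (\<chi> i. lam $ i ^ 0) = mat 1"
    by (simp add: vec_eq_iff mat_def)
  then show ?case using Q by (simp add: orthogonal_matrix_def)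
next
  case (Suc k)
  have "mdiag lam ** mdiag (\<chi> i. lam $ i ^ k) = mdiag (\<chi> i. lam $ i ^ Suc k)"
    by (simp add: vec_eq_iff)
  then have "Q ** mdiag lam ** mdiag (\<chi> i. lam $ i ^ k) = Q ** mdiag (\<chi> i. lam $ i ^ Suc k)"
    by (simp add: matrix_mul_assoc[symmetric])
  then show ?case
    by (simp add: Suc matrix_mul_assoc orthogonal_matrix_cancel[OF Q])
qed

lemma matrix_sumsI:
  fixes F :: "nat \<Rightarrow> real^'n^'m"
  assumes "\<And>i j. (\<lambda>k. F k $ i $ j) sums (S $ i $ j)"
  shows "F sums S"
  unfolding sums_def using assms
  by (intro vec_tendstoI) (simp add: sums_def)

lemma mexp_diagonalized:
  assumes Q: "orthogonal_matrix Q"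
  shows "mexp (Q ** mdiag lam ** transpose Q) = Q ** mdiag (\<chi> i. exp (lam $ i)) ** transpose Q"
proof -
  have "(\<lambda>k. (1 / fact k) *\<^sub>R mdiag (\<chi> i. lam $ i ^ k)) sums mdiag (\<chi> i. exp (lam $ i))"
  proof (rule matrix_sumsI)
    fix i j
    show "(\<lambda>k. ((1 / fact k) *\<^sub>R mdiag (\<chi> i. lam $ i ^ k)) $ i $ j) sums
        (mdiag (\<chi> i. exp (lam $ i)) $ i $ j)"
      using exp_converges[of "lam $ i"] by (cases "i = j") (simp_all add: divide_inverse)
  qed
  from bounded_linear.sums[OF bounded_linear_matrix_sandwich this, of Q "transpose Q"]
  have "(\<lambda>k. (1 / fact k) *\<^sub>R mpow (Q ** mdiag lam ** transpose Q) k) sums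
      (Q ** mdiag (\<chi> i. exp (lam $ i)) ** transpose Q)"
    by (simp add: mpow_diagonalized[OF Q] linear_cmul[OF bounded_linear.linear[OF bounded_linear_matrix_sandwich]])
  then show ?thesis using mexp_sums sums_unique2 by blast
qed

text \<open>The first divided difference of t^k at a and b, that is, the sum of a^i b^(k-1-i) over i
  < k. The recursion mirrors \<open>mpow_deriv\<close> and stays meaningful at a = b, where no
  quotient exists.\<close>

primrec pow_divdiff :: "real \<Rightarrow> real \<Rightarrow> nat \<Rightarrow> real" where
  "pow_divdiff a b 0 = 0"
| "pow_divdiff a b (Suc k) = a * pow_divdiff a b k + b ^ k"

lemma pow_divdiff_diff: "(a - b) * pow_divdiff a b k = a ^ k - b ^ k"
proof (induction k)
  case (Suc k)
  have "(a - b) * pow_divdiff a b (Suc k) = a * ((a - b) * pow_divdiff a b k) + (a - b) * b ^ k"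
    by (simp add: algebra_simps)
  then show ?case unfolding Suc by (simp add: algebra_simps)
qed simp

lemma pow_divdiff_same: "pow_divdiff a a (Suc k) = real (Suc k) * a ^ k"
  by (induction k) (auto simp: algebra_simps)

lemma pow_divdiff_sums: "(\<lambda>k. (1 / fact k) * pow_divdiff a b k) sums dk_delta a b"
proof (cases "a = b")
  case True
  have "(\<lambda>k. (1 / fact (Suc k)) * pow_divdiff a a (Suc k)) = (\<lambda>k. inverse (fact k) * a ^ k)"
    by (auto simp: pow_divdiff_same fun_eq_iff field_simps simp del: of_nat_Suc pow_divdiff.simps)
  then have "(\<lambda>k. (1 / fact (Suc k)) * pow_divdiff a a (Suc k)) sums exp a"
    using exp_converges[of a] by simp
  then have "(\<lambda>k. (1 / fact k) * pow_divdiff a a k) sums (exp a + (1 / fact 0) * pow_divdiff a a 0)"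
    by (rule sums_Suc)
  with True show ?thesis by (simp add: dk_delta_def)
next
  case False
  have "(\<lambda>k. (inverse (fact k) * a ^ k - inverse (fact k) * b ^ k) / (a - b)) sums ((exp a - exp b) / (a - b))"
    using exp_converges[of a] exp_converges[of b] by (intro sums_divide sums_diff) simp_all
  moreover have "(inverse (fact k) * a ^ k - inverse (fact k) * b ^ k) / (a - b) = (1 / fact k) * pow_divdiff a b k" for k
    unfolding right_diff_distrib[symmetric] pow_divdiff_diff[symmetric] using False by (simp add: field_simps)
  ultimately show ?thesis using False by (simp add: dk_delta_def)
qed

text \<open>In the eigenbasis, left multiplication by A scales row i by \<open>lam $ i\<close> and
  right multiplication by A^k scales column j by the k-th power of \<open>lam $ j\<close>; entrywise
  this is the recursion of \<open>pow_divdiff\<close>.\<close>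

lemma mpow_deriv_diagonalized:
  assumes Q: "orthogonal_matrix Q"
  shows "mpow_deriv (Q ** mdiag lam ** transpose Q) k H =
    Q ** hadamard (\<chi> i j. pow_divdiff (lam $ i) (lam $ j) k) (transpose Q ** H ** Q) ** transpose Q"
proof (induction k)
  case 0
  have "hadamard (\<chi> i j. pow_divdiff (lam $ i) (lam $ j) 0) (transpose Q ** H ** Q) = 0"
    by (simp add: vec_eq_iff)
  then show ?case by (simp add: linear_0[OF bounded_linear.linear[OF bounded_linear_matrix_sandwich]])
next
  case (Suc k)
  let ?X = "transpose Q ** H ** Q"
  have "hadamard (\<chi> i j. pow_divdiff (lam $ i) (lam $ j) (Suc k)) ?X =
      mdiag lam ** hadamard (\<chi> i j. pow_divdiff (lam $ i) (lam $ j) k) ?X + ?X ** mdiag (\<chi> i. lam $ i ^ k)"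
    by (simp add: vec_eq_iff algebra_simps)
  moreover have "Q ** transpose Q = mat 1" using Q by (simp add: orthogonal_matrix_def)
  ultimately show ?case
    by (simp add: Suc mpow_diagonalized[OF Q] matrix_mul_assoc orthogonal_matrix_cancel[OF Q]
        matrix_mult.add_left matrix_mult.add_right)
qed

theorem has_derivative_mexp:
  assumes Q: "orthogonal_matrix Q"
  shows "(mexp has_derivative dexp Q lam) (at (Q ** mdiag lam ** transpose Q))"
proof -
  have "(\<Sum>k. (1 / fact k) *\<^sub>R mpow_deriv (Q ** mdiag lam ** transpose Q) k H) = dexp Q lam H" for H
  proof -
    let ?X = "transpose Q ** H ** Q"
    have "(\<lambda>k. (1 / fact k) *\<^sub>R hadamard (\<chi> i j. pow_divdiff (lam $ i) (lam $ j) k) ?X) sums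
        hadamard (\<chi> i j. dk_delta (lam $ i) (lam $ j)) ?X"
    proof (rule matrix_sumsI)
      fix i j
      show "(\<lambda>k. ((1 / fact k) *\<^sub>R hadamard (\<chi> i j. pow_divdiff (lam $ i) (lam $ j) k) ?X) $ i $ j) sums
          (hadamard (\<chi> i j. dk_delta (lam $ i) (lam $ j)) ?X $ i $ j)"
        using sums_mult2[OF pow_divdiff_sums[of "lam $ i" "lam $ j"], of "?X $ i $ j"] by simp
    qed
    from bounded_linear.sums[OF bounded_linear_matrix_sandwich this, of Q "transpose Q"]
    show ?thesis
      unfolding dexp_def
      by (intro sums_unique[symmetric])
         (simp add: mpow_deriv_diagonalized[OF Q] linear_cmul[OF bounded_linear.linear[OF bounded_linear_matrix_sandwich]])
  qed
  then show ?thesis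
    using has_derivative_mexp_series[of "Q ** mdiag lam ** transpose Q"] by simp
qed

section \<open>Monotonicity of the matrix exponential and the unit diagonal\<close>

lemma dk_delta_pos: "dk_delta a b > 0"
  by (auto simp: dk_delta_def divide_simps)

lemma dk_delta_commute: "dk_delta a b = dk_delta b a"
  by (auto simp: dk_delta_def divide_simps) (simp_all add: algebra_simps)

lemma orthogonal_matrix_mult:
  assumes "orthogonal_matrix (Q :: real^'n^'n)"
  shows "Q ** transpose Q = mat 1" "transpose Q ** Q = mat 1"
  using assms by (simp_all add: orthogonal_matrix_def)

lemma inner_sandwich:
  fixes Q :: "real^'n^'m" and X :: "real^'n^'n" and Y :: "real^'m^'m"
  shows "(Q ** X ** transpose Q) \<bullet> Y = X \<bullet> (transpose Q ** Y ** Q)"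
  using inner_matrix_mult_right[of "Q ** X" "transpose Q" Y] inner_matrix_mult_left[of Q X "Y ** Q"]
  by (simp add: matrix_mul_assoc)

text \<open>The bilinear form of \<open>dexp\<close> is diagonal in the eigenbasis, from which both
  self-adjointness and positivity can be read off.\<close>

lemma dexp_inner:
  "dexp Q lam H \<bullet> K = (\<Sum>i\<in>UNIV. \<Sum>j\<in>UNIV. dk_delta (lam $ i) (lam $ j) *
     ((transpose Q ** H ** Q) $ i $ j * (transpose Q ** K ** Q) $ i $ j))"
  unfolding dexp_def inner_sandwich by (simp add: inner_vec_def mult_ac)

lemma dexp_self_adjoint: "dexp Q lam H \<bullet> K = H \<bullet> dexp Q lam K"
  using dexp_inner[of Q lam K H] by (simp add: dexp_inner inner_commute[of H] mult_ac)

lemma dexp_pos: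
  assumes Q: "orthogonal_matrix Q" and H: "H \<noteq> 0"
  shows "dexp Q lam H \<bullet> H > 0"
proof -
  let ?X = "transpose Q ** H ** Q"
  have "Q ** ?X ** transpose Q = H"
    by (simp add: matrix_mul_assoc orthogonal_matrix_cancel[OF Q] orthogonal_matrix_mult[OF Q])
  then have "?X \<noteq> 0"
    using H by auto
  then obtain i j where ij: "?X $ i $ j \<noteq> 0"
    by (auto simp: vec_eq_iff)
  let ?f = "\<lambda>i j. dk_delta (lam $ i) (lam $ j) * (?X $ i $ j * ?X $ i $ j)"
  have nn: "?f i j \<ge> 0" for i j
    using dk_delta_pos[of "lam $ i" "lam $ j"] by (simp add: zero_le_mult_iff)
  have "0 < ?f i j"
    using ij dk_delta_pos[of "lam $ i" "lam $ j"]
    by (metis mult_pos_pos not_real_square_gt_zero)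
  also have "\<dots> \<le> (\<Sum>j\<in>UNIV. ?f i j)"
    by (intro member_le_sum) (auto simp: nn)
  also have "\<dots> \<le> (\<Sum>i\<in>UNIV. \<Sum>j\<in>UNIV. ?f i j)"
    by (rule member_le_sum[where f="\<lambda>i. \<Sum>j\<in>UNIV. ?f i j"]) (auto simp: nn intro!: sum_nonneg)
  finally show ?thesis by (simp add: dexp_inner)
qed

lemma transpose_mdiag [simp]: "transpose (mdiag v) = mdiag v"
  by (auto simp: vec_eq_iff transpose_def)

lemma transpose_sandwich_mdiag [simp]:
  "transpose (Q ** mdiag v ** transpose Q) = Q ** mdiag v ** transpose Q"
  by (simp add: matrix_transpose_mul matrix_mul_assoc)

text \<open>Together with self-adjointness this gives the derivative of the trace of
  \<open>mexp\<close>: in direction H it is \<open>mexp A \<bullet> H\<close>.\<close>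

lemma dexp_mat_1:
  assumes Q: "orthogonal_matrix Q"
  shows "dexp Q lam (mat 1) = mexp (Q ** mdiag lam ** transpose Q)"
proof -
  have "hadamard (\<chi> i j. dk_delta (lam $ i) (lam $ j)) (mat 1) = mdiag (\<chi> i. exp (lam $ i))"
    by (auto simp: vec_eq_iff mat_def dk_delta_def)
  then show ?thesis
    by (simp add: dexp_def mexp_diagonalized[OF Q] orthogonal_matrix_mult[OF Q])
qed

lemma transpose_hadamard: "transpose (hadamard G X) = hadamard (transpose G) (transpose X)"
  by (simp add: vec_eq_iff transpose_def)

lemma transpose_dexp:
  assumes "transpose H = H"
  shows "transpose (dexp Q lam H) = dexp Q lam H"
proof -
  have "transpose (\<chi> i j. dk_delta (lam $ i) (lam $ j)) = (\<chi> i j. dk_delta (lam $ i) (lam $ j))"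
    by (simp add: vec_eq_iff transpose_def dk_delta_commute)
  then show ?thesis
    by (simp add: dexp_def matrix_transpose_mul transpose_hadamard assms matrix_mul_assoc)
qed

text \<open>Along the segment from B to A the inner product with A - B has derivative
  \<open>dexp Q lam H \<bullet> H > 0\<close>. The eigenbasis is chosen anew at each t, so no
  regularity of Q in t enters.\<close>

lemma mexp_strict_mono:
  fixes A B :: "real^'n^'n"
  assumes "transpose A = A" "transpose B = B" "A \<noteq> B"
  shows "(mexp A - mexp B) \<bullet> (A - B) > 0"
proof -
  define H where "H = A - B"
  have "mexp (B + 0 *\<^sub>R H) \<bullet> H < mexp (B + 1 *\<^sub>R H) \<bullet> H"
  proof (rule DERIV_pos_imp_increasing[where f="\<lambda>t. mexp (B + t *\<^sub>R H) \<bullet> H"])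
    fix t :: real
    have "transpose (B + t *\<^sub>R H) = B + t *\<^sub>R H"
      using assms by (simp add: vec_eq_iff transpose_def H_def)
    then obtain Q lam where Q: "orthogonal_matrix Q" and e: "B + t *\<^sub>R H = Q ** mdiag lam ** transpose Q"
      by (rule symmetric_matrix_diagonalization)
    have d: "(mexp has_derivative dexp Q lam) (at (B + t *\<^sub>R H))"
      unfolding e by (rule has_derivative_mexp[OF Q])
    have "((\<lambda>t. B + t *\<^sub>R H) has_derivative (\<lambda>s. s *\<^sub>R H)) (at t)"
      by (auto intro!: derivative_eq_intros)
    from has_derivative_compose[OF this d]
    have "((\<lambda>t. mexp (B + t *\<^sub>R H) \<bullet> H) has_derivative (\<lambda>s. dexp Q lam (s *\<^sub>R H) \<bullet> H)) (at t)"
      by (rule has_derivative_inner_left)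
    moreover have "(\<lambda>s. dexp Q lam (s *\<^sub>R H) \<bullet> H) = (*) (dexp Q lam H \<bullet> H)"
      by (auto simp: fun_eq_iff linear_cmul[OF has_derivative_linear[OF d]])
    ultimately have "((\<lambda>t. mexp (B + t *\<^sub>R H) \<bullet> H) has_real_derivative (dexp Q lam H \<bullet> H)) (at t)"
      by (simp add: has_field_derivative_def)
    moreover have "dexp Q lam H \<bullet> H > 0"
      using assms by (intro dexp_pos Q) (simp add: H_def)
    ultimately show "\<exists>y. ((\<lambda>t. mexp (B + t *\<^sub>R H) \<bullet> H) has_real_derivative y) (at t) \<and> 0 < y"
      by blast
  qed simp
  then show ?thesis by (simp add: H_def inner_diff_left)
qed

lemma mexp_inj_symmetric:
  assumes "transpose A = A" "transpose B = B" "mexp A = mexp B"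
  shows "A = B"
  using mexp_strict_mono[OF assms(1,2)] assms(3) by fastforce

section \<open>Symmetric logarithms of positive definite matrices\<close>

lemma mlog_mexp:
  assumes "transpose A = A"
  shows "mlog (mexp A) = A"
  unfolding mlog_def using assms by (intro the_equality) (auto intro: mexp_inj_symmetric)

lemma inner_diagonalized:
  "x \<bullet> ((Q ** mdiag v ** transpose Q) *v x) = (\<Sum>i\<in>UNIV. v $ i * ((transpose Q *v x) $ i)\<^sup>2)"
proof -
  have "x \<bullet> ((Q ** mdiag v ** transpose Q) *v x) = (transpose Q *v x) \<bullet> (mdiag v *v (transpose Q *v x))"
    by (simp add: matrix_vector_mul_assoc[symmetric] dot_lmul_matrix[symmetric] transpose_matrix_vector)
  moreover have "(mdiag v *v y) $ i = v $ i * y $ i" for y i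
    by (simp add: matrix_vector_mult_def if_distrib if_distribR cong: if_cong)
  ultimately show ?thesis
    by (simp add: inner_vec_def power2_eq_square mult_ac)
qed

lemma mexp_symmetric:
  assumes "transpose A = A"
  shows "transpose (mexp A) = mexp A"
proof -
  obtain Q lam where Q: "orthogonal_matrix Q" and e: "A = Q ** mdiag lam ** transpose Q"
    by (rule symmetric_matrix_diagonalization[OF assms])
  show ?thesis
    unfolding e by (simp add: mexp_diagonalized[OF Q])
qed

lemma mexp_positive_definite:
  assumes "transpose A = A" "x \<noteq> 0"
  shows "x \<bullet> (mexp A *v x) > 0"
proof -
  obtain Q lam where Q: "orthogonal_matrix Q" and e: "A = Q ** mdiag lam ** transpose Q"
    by (rule symmetric_matrix_diagonalization[OF assms(1)])
  let ?y = "transpose Q *v x"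
  have "Q *v ?y = x"
    by (simp only: matrix_vector_mul_assoc orthogonal_matrix_mult[OF Q] matrix_vector_mul_lid)
  then have "?y \<noteq> 0"
    using assms(2) by auto
  then obtain i where i: "?y $ i \<noteq> 0" by (auto simp: vec_eq_iff)
  then have "0 < exp (lam $ i) * (?y $ i)\<^sup>2" by simp
  also have "\<dots> \<le> (\<Sum>i\<in>UNIV. exp (lam $ i) * (?y $ i)\<^sup>2)"
    by (rule member_le_sum) auto
  finally show ?thesis
    unfolding e mexp_diagonalized[OF Q] inner_diagonalized by simp
qed

lemma positive_definite_has_log:
  fixes C :: "real^'n^'n"
  assumes C: "transpose C = C" and pos: "\<And>x. x \<noteq> 0 \<Longrightarrow> x \<bullet> (C *v x) > 0"
  obtains A where "transpose A = A" "mexp A = C"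
proof -
  obtain Q m where Q: "orthogonal_matrix Q" and e: "C = Q ** mdiag m ** transpose Q"
    by (rule symmetric_matrix_diagonalization[OF C])
  have m: "m $ i > 0" for i
  proof -
    \<comment> \<open>The i-th eigenvector, at which the quadratic form of C takes the value
      \<open>m $ i\<close>.\<close>
    let ?x = "Q *v axis i 1"
    have y: "transpose Q *v ?x = axis i 1"
      by (simp add: matrix_vector_mul_assoc orthogonal_matrix_mult[OF Q])
    have "?x \<noteq> 0"
      using y by auto
    from pos[OF this] show ?thesis
      unfolding e inner_diagonalized y
      by (simp add: axis_def if_distrib if_distribR cong: if_cong)
  qed
  have "mexp (Q ** mdiag (\<chi> i. ln (m $ i)) ** transpose Q) = C"
    unfolding mexp_diagonalized[OF Q] e using m by simp
  with that show ?thesis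
    by (metis transpose_sandwich_mdiag)
qed

section \<open>Existence and uniqueness of the diagonal of the logarithm\<close>

lemma bounded_linear_mdiag: "bounded_linear (mdiag :: real^'n \<Rightarrow> real^'n^'n)"
  unfolding linear_conv_bounded_linear[symmetric]
  by (rule linearI) (auto simp: vec_eq_iff)

lemma inner_mdiag: "X \<bullet> mdiag h = (\<Sum>i\<in>UNIV. X $ i $ i * h $ i)"
  by (simp add: inner_vec_def if_distrib if_distribR cong: if_cong)

lemma inner_mat_1: "X \<bullet> mat 1 = (\<Sum>i\<in>UNIV. X $ i $ i)"
  by (simp add: inner_vec_def mat_def if_distrib if_distribR cong: if_cong)

text \<open>Jensen's inequality: a diagonal entry of A averages the eigenvalues with weights
  \<open>(Q $ i $ k)\<^sup>2\<close> that sum to 1. The proof uses the tangent of exp at that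
  average c.\<close>

lemma exp_diag_le_mexp_diag:
  fixes A :: "real^'n^'n"
  assumes "transpose A = A"
  shows "exp (A $ i $ i) \<le> mexp A $ i $ i"
proof -
  obtain Q lam where Q: "orthogonal_matrix Q" and e: "A = Q ** mdiag lam ** transpose Q"
    by (rule symmetric_matrix_diagonalization[OF assms])
  have entry: "(Q ** mdiag v ** transpose Q) $ i $ i = (\<Sum>k\<in>UNIV. (Q $ i $ k)\<^sup>2 * v $ k)" for v
    by (subst matrix_matrix_mult_def) (simp add: transpose_def power2_eq_square mult_ac)
  define c where "c = A $ i $ i"
  have c: "(\<Sum>k\<in>UNIV. (Q $ i $ k)\<^sup>2 * lam $ k) = c"
    using entry[of lam] by (simp add: c_def e)
  have "(Q ** transpose Q) $ i $ i = (\<Sum>k\<in>UNIV. (Q $ i $ k)\<^sup>2)"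
    by (simp add: matrix_matrix_mult_def transpose_def power2_eq_square)
  then have one: "(\<Sum>k\<in>UNIV. (Q $ i $ k)\<^sup>2) = 1"
    by (simp add: orthogonal_matrix_mult[OF Q] mat_def)
  have "exp c = (\<Sum>k\<in>UNIV. (Q $ i $ k)\<^sup>2 * (exp c * (1 - c))) + (\<Sum>k\<in>UNIV. (Q $ i $ k)\<^sup>2 * lam $ k) * exp c"
    unfolding c sum_distrib_right[symmetric] one by (simp add: algebra_simps)
  also have "\<dots> = (\<Sum>k\<in>UNIV. (Q $ i $ k)\<^sup>2 * (exp c * (1 + (lam $ k - c))))"
    unfolding sum_distrib_right sum.distrib[symmetric] by (simp add: algebra_simps)
  also have "\<dots> \<le> (\<Sum>k\<in>UNIV. (Q $ i $ k)\<^sup>2 * exp (lam $ k))"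
  proof (intro sum_mono mult_left_mono)
    fix k
    have "exp c * (1 + (lam $ k - c)) \<le> exp c * exp (lam $ k - c)"
      by (intro mult_left_mono exp_ge_add_one_self) auto
    then show "exp c * (1 + (lam $ k - c)) \<le> exp (lam $ k)"
      by (simp add: exp_diff)
  qed auto
  also have "\<dots> = mexp A $ i $ i"
    unfolding e mexp_diagonalized[OF Q] entry by simp
  finally show ?thesis by (simp add: c_def)
qed

text \<open>Gives coercivity of the function to be minimised. For t \<ge> 0 the quadratic Taylor
  bound of exp leaves the slack ((t - 1)^2 + 1)/2.\<close>

lemma exp_minus_ge_abs: "\<bar>t\<bar> \<le> exp t - (t::real)"
proof (cases "t \<ge> 0")
  case True
  have "2 * t \<le> 1 + t + t\<^sup>2 / 2"
    using zero_le_power2[of "t - 1"] by (simp add: power2_eq_square algebra_simps)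
  also have "\<dots> \<le> exp t" by (rule exp_lower_Taylor_quadratic[OF True])
  finally show ?thesis using True by simp
qed (use exp_gt_zero[of t] in linarith)

text \<open>The diagonal is found by minimising the strictly convex, coercive function
  \<open>x \<mapsto> tr (exp (S + diag x)) - \<Sum>i. x i\<close>.\<close>
lemma mexp_unit_diagonal_exists:
  fixes S :: "real^'n^'n"
  assumes S: "transpose S = S" and S0: "\<And>i. S $ i $ i = 0"
  obtains x where "\<And>i. mexp (S + mdiag x) $ i $ i = 1"
proof -
  define F where "F x = mexp (S + mdiag x) \<bullet> mat 1 - (\<Sum>i\<in>UNIV. x $ i)" for x :: "real^'n"
  have sym: "transpose (S + mdiag x) = S + mdiag x" for x :: "real^'n"
    using S by (auto simp: vec_eq_iff transpose_def)
  have ge: "norm x \<le> F x" for x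
  proof -
    have "norm x \<le> (\<Sum>i\<in>UNIV. \<bar>x $ i\<bar>)" by (rule norm_le_l1_cart)
    also have "\<dots> \<le> (\<Sum>i\<in>UNIV. mexp (S + mdiag x) $ i $ i - x $ i)"
    proof (rule sum_mono)
      fix i
      show "\<bar>x $ i\<bar> \<le> mexp (S + mdiag x) $ i $ i - x $ i"
        using exp_minus_ge_abs[of "x $ i"] exp_diag_le_mexp_diag[OF sym, of x i] S0[of i] by simp
    qed
    finally show ?thesis by (simp add: F_def inner_mat_1 sum_subtractf)
  qed
  have der: "(F has_derivative (\<lambda>h. mexp (S + mdiag x) \<bullet> mdiag h - (\<Sum>i\<in>UNIV. h $ i))) (at x)" for x
  proof -
    obtain Q lam where Q: "orthogonal_matrix Q" and e: "S + mdiag x = Q ** mdiag lam ** transpose Q"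
      by (rule symmetric_matrix_diagonalization[OF sym])
    have d: "(mexp has_derivative dexp Q lam) (at (S + mdiag x))"
      unfolding e by (rule has_derivative_mexp[OF Q])
    have "((\<lambda>x. S + mdiag x) has_derivative mdiag) (at x)"
      using has_derivative_add[OF has_derivative_const bounded_linear_imp_has_derivative[OF bounded_linear_mdiag]]
      by simp
    from has_derivative_compose[OF this d]
    have "(F has_derivative (\<lambda>h. dexp Q lam (mdiag h) \<bullet> mat 1 - (\<Sum>i\<in>UNIV. h $ i))) (at x)"
      unfolding F_def
      by (intro has_derivative_diff has_derivative_inner_left has_derivative_sum
          bounded_linear_imp_has_derivative bounded_linear_vec_nth)
    moreover have "dexp Q lam (mdiag h) \<bullet> mat 1 = mexp (S + mdiag x) \<bullet> mdiag h" for h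
      using dexp_self_adjoint[of Q lam "mdiag h" "mat 1"] by (simp add: e dexp_mat_1[OF Q] inner_commute)
    ultimately show ?thesis by simp
  qed
  \<comment> \<open>The radius \<open>F 0\<close> makes the minimum over the ball global: outside
    it, \<open>F y \<ge> norm y > F 0\<close>.\<close>
  have "continuous_on (cball 0 (F 0)) F"
    by (intro continuous_at_imp_continuous_on ballI has_derivative_continuous[OF der])
  moreover have "F 0 \<ge> 0" using ge[of 0] by simp
  ultimately have "\<exists>x\<in>cball 0 (F 0). \<forall>y\<in>cball 0 (F 0). F x \<le> F y"
    by (intro continuous_attains_inf) auto
  then obtain x where x: "\<And>y. y \<in> cball 0 (F 0) \<Longrightarrow> F x \<le> F y"
    by blast
  have min: "F x \<le> F y" for y
  proof (cases "y \<in> cball 0 (F 0)")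
    case False
    have "F x \<le> F 0" using x[of 0] \<open>F 0 \<ge> 0\<close> by simp
    also have "\<dots> \<le> F y" using False ge[of y] by simp
    finally show ?thesis .
  qed (rule x)
  \<comment> \<open>Stationarity at the minimum; in direction \<open>axis i 1\<close> the derivative
    is the i-th diagonal entry of the exponential minus 1.\<close>
  have "(\<lambda>h. mexp (S + mdiag x) \<bullet> mdiag h - (\<Sum>i\<in>UNIV. h $ i)) = (\<lambda>h. 0)"
    by (rule differential_zero_maxmin[OF UNIV_I open_UNIV der]) (use min in auto)
  then have "mexp (S + mdiag x) \<bullet> mdiag (axis i 1) - (\<Sum>j\<in>UNIV. axis i 1 $ j) = 0" for i
    by (rule fun_cong)
  then have "mexp (S + mdiag x) $ i $ i = 1" for i
    by (simp add: inner_mdiag axis_def if_distrib cong: if_cong)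
  with that show ?thesis by blast
qed

text \<open>The two arguments differ by a diagonal matrix, so pairing that difference with the
  difference of the exponentials only sees their equal diagonals and gives 0, against strict
  monotonicity.\<close>

lemma mexp_diagonal_inj:
  fixes S :: "real^'n^'n"
  assumes S: "transpose S = S"
    and eq: "\<And>i. mexp (S + mdiag x) $ i $ i = mexp (S + mdiag y) $ i $ i"
  shows "x = y"
proof (rule ccontr)
  assume "x \<noteq> y"
  then have ne: "S + mdiag x \<noteq> S + mdiag y"
    by (auto simp: vec_eq_iff)
  have sym: "transpose (S + mdiag x) = S + mdiag x" for x :: "real^'n"
    using S by (auto simp: vec_eq_iff transpose_def)
  have "S + mdiag x - (S + mdiag y) = mdiag (x - y)"
    by (simp add: vec_eq_iff)
  then have "(mexp (S + mdiag x) - mexp (S + mdiag y)) \<bullet> mdiag (x - y) > 0"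
    using mexp_strict_mono[OF sym sym ne] by simp
  then show False by (simp add: inner_mdiag eq)
qed

section \<open>The Jacobian of the correlation matrix\<close>

lemma vecm_nth [simp]: "vecm B $ ij = B $ fst ij $ snd ij"
  by (simp add: vecm_def)

lemma sum_UNIV_prod: "(\<Sum>ij\<in>(UNIV :: ('a::finite \<times> 'b::finite) set). f ij) = (\<Sum>i\<in>UNIV. \<Sum>j\<in>UNIV. f (i, j))"
  by (simp add: sum.cartesian_product flip: UNIV_Times_UNIV)

lemma vecm_inner: "vecm A \<bullet> vecm B = A \<bullet> B"
  by (simp add: inner_vec_def sum_UNIV_prod)

lemma vecm_inject [simp]: "vecm A = vecm B \<longleftrightarrow> A = B"
  by (auto simp: vec_eq_iff)

lemma bounded_linear_vecm: "bounded_linear (vecm :: real^'n^'n \<Rightarrow> _)"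
  unfolding linear_conv_bounded_linear[symmetric]
  by (rule linearI) (auto simp: vec_eq_iff)

definition unvecm :: "real^('n \<times> 'n) \<Rightarrow> real^'n^'n" where
  "unvecm v = (\<chi> i j. v $ (i, j))"

lemma vecm_unvecm [simp]: "vecm (unvecm v) = v"
  by (simp add: vec_eq_iff unvecm_def)

lemma unvecm_nth [simp]: "unvecm v $ i $ j = v $ (i, j)"
  by (simp add: unvecm_def)

lemma bounded_linear_unvecm: "bounded_linear (unvecm :: _ \<Rightarrow> real^'n^'n)"
  unfolding linear_conv_bounded_linear[symmetric]
  by (rule linearI) (auto simp: vec_eq_iff)

lemma kron_vecm: "kron P R *v vecm X = vecm (R ** X ** transpose P)"
proof -
  have "(kron P R *v vecm X) $ (i, j) = (R ** X ** transpose P) $ i $ j" for i j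
  proof -
    have "(kron P R *v vecm X) $ (i, j) = (\<Sum>k\<in>UNIV. \<Sum>l\<in>UNIV. R $ i $ k * X $ k $ l * P $ j $ l)"
      by (simp add: matrix_vector_mult_def kron_def sum_UNIV_prod mult_ac)
    also have "\<dots> = (\<Sum>l\<in>UNIV. \<Sum>k\<in>UNIV. R $ i $ k * X $ k $ l * P $ j $ l)"
      by (rule sum.swap)
    also have "\<dots> = (R ** X ** transpose P) $ i $ j"
      by (simp add: matrix_matrix_mult_def transpose_def sum_distrib_right)
    finally show ?thesis .
  qed
  then show ?thesis by (simp add: vec_eq_iff)
qed

lemma transpose_kron: "transpose (kron P R) = kron (transpose P) (transpose R)"
  by (simp add: vec_eq_iff transpose_def kron_def)

lemma Xi_vecm: "Xi lam *v vecm X = vecm (hadamard (\<chi> i j. dk_delta (lam $ i) (lam $ j)) X)"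
  by (simp add: vec_eq_iff matrix_vector_mult_def Xi_def if_distrib if_distribR cong: if_cong)

text \<open>Identifies the matrix \<Gamma> of the theorem as the Daleckii-Krein derivative written
  in vec coordinates.\<close>

lemma kron_Xi_vecm:
  "(kron Q Q ** Xi lam ** transpose (kron Q Q)) *v vecm H = vecm (dexp Q lam H)"
  by (simp only: matrix_vector_mul_assoc[symmetric] transpose_kron kron_vecm Xi_vecm dexp_def
      transpose_transpose)

lemma Ed_vecm: "Ed *v vecm X = (\<chi> i. X $ i $ i)"
  by (simp add: vec_eq_iff matrix_vector_mult_def Ed_def if_distrib if_distribR cong: if_cong)

lemma transpose_Ed_mult: "transpose Ed *v x = vecm (mdiag x)"
proof -
  have "(transpose Ed *v x) $ (i, j) = vecm (mdiag x) $ (i, j)" for i j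
  proof -
    have "(transpose Ed *v x) $ (i, j) = (\<Sum>m\<in>UNIV. (if (i, j) = (m, m) then 1 else 0) * x $ m)"
      by (simp only: matrix_vector_mult_def transpose_def Ed_def vec_lambda_beta)
    also have "\<dots> = (\<Sum>m\<in>UNIV. if m = i then (if i = j then x $ m else 0) else 0)"
      by (intro sum.cong) auto
    finally have "(transpose Ed *v x) $ (i, j) = \<dots>" .
    then show ?thesis by simp
  qed
  then show ?thesis by (simp add: vec_eq_iff)
qed

lemma El_vecm: "El p *v vecm X = vecl p X"
  by (simp add: vec_eq_iff matrix_vector_mult_def El_def vecl_def if_distrib if_distribR cong: if_cong)

text \<open>For a valid index map this is the symmetric matrix with zero diagonal and
  \<open>vecl\<close> equal to g. It is built from \<open>transpose (El p + Eu p)\<close> so that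
  the outer factors of M appear by unfolding.\<close>

definition offdiag :: "('d::finite \<Rightarrow> 'n::finite \<times> 'n) \<Rightarrow> real^'d \<Rightarrow> real^'n^'n" where
  "offdiag p g = unvecm (transpose (El p + Eu p) *v g)"

lemma vecm_offdiag: "vecm (offdiag p g) = transpose (El p + Eu p) *v g"
  by (simp add: offdiag_def)

lemma bounded_linear_offdiag: "bounded_linear (offdiag p)"
  unfolding offdiag_def
  by (intro bounded_linear_compose[OF bounded_linear_unvecm] matrix_vector_mul_bounded_linear)

lemma offdiag_nth:
  "offdiag p g $ i $ j = (\<Sum>k\<in>UNIV. (if (i, j) = p k then g $ k else 0) + (if (j, i) = p k then g $ k else 0))"
  unfolding offdiag_def unvecm_nth matrix_vector_mult_def transpose_def El_def Eu_def
  by (simp, intro sum.cong) auto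

lemma transpose_offdiag: "transpose (offdiag p g) = offdiag p g"
  by (simp add: vec_eq_iff transpose_def offdiag_nth add.commute)

section \<open>Symmetric matrices in below-diagonal and diagonal coordinates\<close>

context
  fixes p :: "'d::{finite,linorder} \<Rightarrow> 'n::{finite,linorder} \<times> 'n"
  assumes p: "vecl_index p"
begin

lemma vecl_index_less: "snd (p k) < fst (p k)"
  using p by (auto simp: vecl_index_def bij_betw_def)

lemma offdiag_diag [simp]: "offdiag p g $ i $ i = 0"
proof -
  have "(i, i) \<noteq> p k" for k using vecl_index_less[of k] by (metis fst_conv order_less_irrefl snd_conv)
  then show ?thesis by (simp add: offdiag_nth)
qed

lemma offdiag_index: "offdiag p g $ fst (p k) $ snd (p k) = g $ k"
proof -
  have inj: "p k = p l \<longleftrightarrow> l = k" for l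
    using p by (auto simp: vecl_index_def bij_betw_def inj_on_def)
  have "(snd (p k), fst (p k)) \<noteq> p l" for l
    using vecl_index_less[of k] vecl_index_less[of l] by (metis fst_conv order_less_asym snd_conv)
  then show ?thesis
    by (simp add: offdiag_nth inj)
qed

lemma vecl_index_surj:
  assumes "j < i"
  obtains k where "p k = (i, j)"
proof -
  have "(i, j) \<in> range p" using p assms by (simp add: vecl_index_def bij_betw_def)
  then show ?thesis using that by (metis rangeE)
qed

lemma symmetric_eq_offdiag:
  assumes "transpose X = X"
  shows "X = offdiag p (vecl p X) + mdiag (\<chi> i. X $ i $ i)"
proof -
  have below: "X $ i $ j = offdiag p (vecl p X) $ i $ j" if ij: "j < i" for i j
  proof -
    obtain k where k: "p k = (i, j)" by (rule vecl_index_surj[OF ij])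
    show ?thesis using offdiag_index[of "vecl p X" k] k by (simp add: vecl_def)
  qed
  have sX: "X $ i $ j = X $ j $ i" for i j
    using assms by (simp add: vec_eq_iff transpose_def)
  have sO: "offdiag p (vecl p X) $ i $ j = offdiag p (vecl p X) $ j $ i" for i j
    using transpose_offdiag[of p "vecl p X"] by (simp add: vec_eq_iff transpose_def)
  have "X $ i $ j = (offdiag p (vecl p X) + mdiag (\<chi> i. X $ i $ i)) $ i $ j" for i j
  proof (cases i j rule: linorder_cases)
    case less
    then show ?thesis using below[OF less] sX[of i j] sO[of i j] by simp
  next
    case greater
    then show ?thesis using below[OF greater] by simp
  qed simp
  then show ?thesis unfolding vec_eq_iff by blast
qed

lemma vecl_offdiag_mdiag: "vecl p (offdiag p g + mdiag x) = g"
  using vecl_index_less by (simp add: vec_eq_iff vecl_def offdiag_index less_imp_neq[symmetric])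

lemma transpose_offdiag_mdiag: "transpose (offdiag p g + mdiag x) = offdiag p g + mdiag x"
  using transpose_offdiag[of p g] by (auto simp: vec_eq_iff transpose_def)

text \<open>Any competing C is positive definite, hence has a symmetric logarithm. Its off-diagonal
  part is fixed by g, and the unit diagonal of C then fixes its diagonal by
  \<open>mexp_diagonal_inj\<close>.\<close>

lemma corr_of_eqI:
  assumes diag: "\<And>i. mexp (offdiag p g + mdiag x) $ i $ i = 1"
  shows "corr_of p g = mexp (offdiag p g + mdiag x)"
  unfolding corr_of_def
proof (rule the_equality)
  show "is_ns_corr (mexp (offdiag p g + mdiag x)) \<and> vecl p (mlog (mexp (offdiag p g + mdiag x))) = g"
    using diag
    by (simp add: is_ns_corr_def mexp_symmetric transpose_offdiag_mdiag mexp_positive_definite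
        mlog_mexp vecl_offdiag_mdiag)
next
  fix C assume C: "is_ns_corr C \<and> vecl p (mlog C) = g"
  then obtain A where A: "transpose A = A" "mexp A = C"
    using positive_definite_has_log[of C] by (auto simp: is_ns_corr_def)
  have "vecl p A = g" using C A(1) mlog_mexp[OF A(1)] by (simp add: A(2))
  then have e: "A = offdiag p g + mdiag (\<chi> i. A $ i $ i)"
    using symmetric_eq_offdiag[OF A(1)] by simp
  have "(\<chi> i. A $ i $ i) = x"
  proof (rule mexp_diagonal_inj[OF transpose_offdiag])
    fix i
    show "mexp (offdiag p g + mdiag (\<chi> i. A $ i $ i)) $ i $ i = mexp (offdiag p g + mdiag x) $ i $ i"
      unfolding e[symmetric] diag A(2) using C by (simp add: is_ns_corr_def)
  qed
  then show "C = mexp (offdiag p g + mdiag x)"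
    using e A(2) by simp
qed

lemma corr_of_obtain:
  obtains x where "corr_of p g = mexp (offdiag p g + mdiag x)"
    "mlog (corr_of p g) = offdiag p g + mdiag x" "\<And>i. mexp (offdiag p g + mdiag x) $ i $ i = 1"
proof -
  obtain x where x: "\<And>i. mexp (offdiag p g + mdiag x) $ i $ i = 1"
    by (rule mexp_unit_diagonal_exists[OF transpose_offdiag[of p g]]) auto
  have "corr_of p g = mexp (offdiag p g + mdiag x)" by (rule corr_of_eqI[OF x])
  with x that show ?thesis by (simp add: mlog_mexp transpose_offdiag_mdiag)
qed

lemma mexp_mlog_corr_of: "mexp (mlog (corr_of p g)) = corr_of p g"
  using corr_of_obtain[of g] by metis

lemma transpose_mlog_corr_of: "transpose (mlog (corr_of p g)) = mlog (corr_of p g)"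
  using corr_of_obtain[of g] transpose_offdiag_mdiag by metis

end

text \<open>The matrix represents the positive form \<open>dexp Q lam H \<bullet> H\<close>
  restricted to diagonal H, so its kernel is trivial.\<close>

lemma invertible_Ed_dexp:
  fixes Q :: "real^'n^'n" and lam :: "real^'n"
  assumes Q: "orthogonal_matrix Q"
  defines "Gm \<equiv> kron Q Q ** Xi lam ** transpose (kron Q Q)"
  shows "invertible (Ed ** Gm ** transpose Ed)"
proof -
  have "x = 0" if x: "(Ed ** Gm ** transpose Ed) *v x = 0" for x
  proof (rule ccontr)
    assume "x \<noteq> 0"
    then have "mdiag x \<noteq> 0" by (auto simp: vec_eq_iff)
    then have "dexp Q lam (mdiag x) \<bullet> mdiag x > 0"
      by (rule dexp_pos[OF Q])
    moreover have "(\<chi> i. dexp Q lam (mdiag x) $ i $ i) = 0"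
      using x unfolding matrix_vector_mul_assoc[symmetric, of "Ed ** Gm"] matrix_vector_mul_assoc[symmetric, of Ed]
      by (simp only: Gm_def transpose_Ed_mult kron_Xi_vecm Ed_vecm)
    ultimately show False
      by (simp add: inner_mdiag vec_eq_iff)
  qed
  then show ?thesis
    unfolding invertible_left_inverse matrix_left_invertible_ker by blast
qed

lemma matrix_inv_mult:
  fixes A :: "real^'n^'n"
  assumes "invertible A"
  shows "A ** matrix_inv A = mat 1" "matrix_inv A ** A = mat 1"
  using assms unfolding invertible_def matrix_inv_def by (metis (mono_tags, lifting) someI_ex)+

text \<open>The logarithm is differentiated rather than C, because the log-density is explicit in
  log C; M appears once its derivative K is followed by \<open>dexp\<close>.\<close>

theorem has_derivative_mlog_corr_of:
  fixes p :: "'d::{finite,linorder} \<Rightarrow> 'n::{finite,linorder} \<times> 'n"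
    and \<gamma> :: "(real, 'd) vec" and Q :: "((real, 'n) vec, 'n) vec" and lam :: "(real, 'n) vec"
  assumes p: "vecl_index p" and Q: "orthogonal_matrix Q"
    and eig: "mlog (corr_of p \<gamma>) = Q ** mdiag lam ** transpose Q"
  defines "Gm \<equiv> kron Q Q ** Xi lam ** transpose (kron Q Q)"
  defines "M \<equiv> transpose (El p + Eu p) ** El p
             ** (mat 1 - Gm ** transpose Ed ** matrix_inv (Ed ** Gm ** transpose Ed) ** Ed)
             ** Gm ** transpose (El p + Eu p)"
  obtains K where "((\<lambda>g. mlog (corr_of p g)) has_derivative K) (at \<gamma>)"
    "\<And>h. vecm (dexp Q lam (K h)) = M *v h"
proof -
  \<comment> \<open>Carrying g along unchanged gives f equal source and target spaces, as the
    inverse function theorem demands.\<close>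
  define f where "f = (\<lambda>(g, x). (g, Ed *v vecm (mexp (offdiag p g + mdiag x))))"
  obtain x where x: "mlog (corr_of p \<gamma>) = offdiag p \<gamma> + mdiag x"
    and diag: "\<And>i. mexp (offdiag p \<gamma> + mdiag x) $ i $ i = 1"
    using corr_of_obtain[OF p, of \<gamma>] by blast
  have A: "offdiag p \<gamma> + mdiag x = Q ** mdiag lam ** transpose Q"
    using eig x by simp
  have inj: "inj f"
  proof (rule injI)
    fix u v assume uv: "f u = f v"
    obtain g y where u: "u = (g, y)" by (cases u)
    obtain g' y' where v: "v = (g', y')" by (cases v)
    have g: "g' = g" using uv by (simp add: f_def u v)
    have "mexp (offdiag p g + mdiag y) $ i $ i = mexp (offdiag p g + mdiag y') $ i $ i" for i
      using uv unfolding f_def u v g by (simp add: Ed_vecm vec_eq_iff)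
    then have "y = y'" by (rule mexp_diagonal_inj[OF transpose_offdiag])
    then show "u = v" by (simp add: u v g)
  qed
  have lin: "((\<lambda>(g, x). offdiag p g + mdiag x) has_derivative (\<lambda>(g, x). offdiag p g + mdiag x)) F" for F
    unfolding split_beta
    by (intro bounded_linear_imp_has_derivative bounded_linear_add
        bounded_linear_compose[OF bounded_linear_offdiag] bounded_linear_compose[OF bounded_linear_mdiag]
        bounded_linear_fst bounded_linear_snd)
  have der: "(f has_derivative (\<lambda>(h, k). (h, Ed *v vecm (L (offdiag p h + mdiag k))))) (at (g, y))"
    if L: "(mexp has_derivative L) (at (offdiag p g + mdiag y))" for g y L
  proof -
    have "((\<lambda>z. mexp (case z of (g, x) \<Rightarrow> offdiag p g + mdiag x)) has_derivative
        (\<lambda>z. L (case z of (g, x) \<Rightarrow> offdiag p g + mdiag x))) (at (g, y))"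
      by (rule has_derivative_compose[OF lin]) (use L in simp)
    from bounded_linear.has_derivative[OF bounded_linear_compose[OF matrix_vector_mul_bounded_linear bounded_linear_vecm] this, of Ed]
    have "((\<lambda>z. (fst z, Ed *v vecm (mexp (case z of (g, x) \<Rightarrow> offdiag p g + mdiag x)))) has_derivative
        (\<lambda>z. (fst z, Ed *v vecm (L (case z of (g, x) \<Rightarrow> offdiag p g + mdiag x))))) (at (g, y))"
      by (intro has_derivative_Pair has_derivative_fst has_derivative_ident)
    then show ?thesis by (simp add: f_def case_prod_beta')
  qed
  have cont: "continuous_on UNIV f"
  proof (intro continuous_at_imp_continuous_on ballI)
    fix z
    show "isCont f z"
      using has_derivative_continuous[OF der[OF has_derivative_mexp_series]] by (cases z) simp
  qed
  let ?E = "Ed ** Gm ** transpose Ed"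
  let ?N = "Gm ** transpose (El p + Eu p)"
  have E: "invertible ?E" unfolding Gm_def by (rule invertible_Ed_dexp[OF Q])
  have dexp_Gm: "vecm (dexp Q lam H) = Gm *v vecm H" for H
    by (simp add: Gm_def kron_Xi_vecm)
  have dm: "(mexp has_derivative dexp Q lam) (at (offdiag p \<gamma> + mdiag x))"
    unfolding A by (rule has_derivative_mexp[OF Q])
  have split: "vecm (offdiag p h + mdiag k) = transpose (El p + Eu p) *v h + transpose Ed *v k" for h k
    by (simp only: linear_add[OF bounded_linear.linear[OF bounded_linear_vecm]] vecm_offdiag transpose_Ed_mult)
  \<comment> \<open>The velocity of the diagonal of the logarithm that, for an off-diagonal velocity
    h, produces the velocity w of the diagonal of the exponential.\<close>
  define \<kappa> where "\<kappa> h w = matrix_inv ?E *v (w - Ed *v (?N *v h))" for h w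
  have Ed0: "Ed *v vecm (dexp Q lam (offdiag p h + mdiag (\<kappa> h w))) = w" for h w
  proof -
    have "Ed *v vecm (dexp Q lam (offdiag p h + mdiag (\<kappa> h w))) = Ed *v (?N *v h) + ?E *v \<kappa> h w"
      unfolding dexp_Gm split by (simp only: matrix_vector_right_distrib matrix_vector_mul_assoc matrix_mul_assoc)
    also have "?E *v \<kappa> h w = w - Ed *v (?N *v h)"
      by (simp only: \<kappa>_def matrix_vector_mul_assoc[of ?E] matrix_inv_mult[OF E] matrix_vector_mul_lid)
    finally show ?thesis by simp
  qed
  have f1: "f (\<gamma>, x) = (\<gamma>, 1)"
    by (simp add: f_def Ed_vecm diag vec_eq_iff)
  \<comment> \<open>Besides continuity and injectivity of f, the theorem asks for a right inverse of
    the derivative at the base point, which \<open>Ed0\<close> provides.\<close>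
  have "(inv f has_derivative (\<lambda>(h, w). (h, \<kappa> h w))) (at (f (\<gamma>, x)))"
    by (rule has_derivative_inverse_strong[OF open_UNIV UNIV_I cont _ der[OF dm]])
       (auto simp: inj fun_eq_iff Ed0)
  then have dinv: "(inv f has_derivative (\<lambda>(h, w). (h, \<kappa> h w))) (at (\<gamma>, 1))"
    by (simp only: f1)
  have log_inv: "mlog (corr_of p g) = (case inv f (g, 1) of (g, x) \<Rightarrow> offdiag p g + mdiag x)" for g
  proof -
    obtain y where y: "mlog (corr_of p g) = offdiag p g + mdiag y"
        "\<And>i. mexp (offdiag p g + mdiag y) $ i $ i = 1"
      using corr_of_obtain[OF p] by metis
    have "f (g, y) = (g, 1)" by (simp add: f_def Ed_vecm y vec_eq_iff)
    then have "inv f (g, 1) = (g, y)" using inj by (metis inv_f_f)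
    then show ?thesis by (simp add: y)
  qed
  \<comment> \<open>Along correlation matrices the diagonal of the exponential stays 1, hence the
    second argument 0.\<close>
  define K where "K h = offdiag p h + mdiag (\<kappa> h 0)" for h
  have "((\<lambda>g. (g, 1 :: (real, 'n) vec)) has_derivative (\<lambda>h. (h, 0))) (at \<gamma>)"
    by (intro has_derivative_Pair has_derivative_ident has_derivative_const)
  from has_derivative_compose[OF has_derivative_compose[OF this dinv] lin]
  have dK: "((\<lambda>g. mlog (corr_of p g)) has_derivative K) (at \<gamma>)"
    by (simp add: log_inv K_def[abs_def])
  have "vecm (dexp Q lam (K h)) = M *v h" for h
  proof -
    \<comment> \<open>X is symmetric with zero diagonal, so it is recovered from its part below the
      diagonal; this is the origin of the factor \<open>transpose (El p + Eu p) ** El p\<close> in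
      M.\<close>
    define X where "X = dexp Q lam (K h)"
    have "transpose X = X"
      unfolding X_def K_def by (intro transpose_dexp transpose_offdiag_mdiag[OF p])
    moreover have "X $ i $ i = 0" for i
      using Ed0[of h 0] by (simp add: X_def K_def Ed_vecm vec_eq_iff)
    then have "mdiag (\<chi> i. X $ i $ i) = 0"
      by (simp add: vec_eq_iff)
    ultimately have "X = offdiag p (vecl p X)"
      using symmetric_eq_offdiag[OF p, of X] by simp
    then have "vecm X = transpose (El p + Eu p) *v (El p *v vecm X)"
      unfolding El_vecm by (metis vecm_offdiag)
    \<comment> \<open>Inserting \<open>\<kappa> h 0\<close> yields the bracket in M, an oblique
      projection onto the kernel of \<open>Ed\<close>.\<close>
    moreover have "vecm X = (mat 1 - Gm ** transpose Ed ** matrix_inv ?E ** Ed) *v (?N *v h)"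
      unfolding X_def dexp_Gm K_def split \<kappa>_def
      by (simp only: matrix_vector_right_distrib matrix_vector_mul_assoc matrix_vector_mult_diff_rdistrib
          matrix_vector_mul_lid matrix_vector_mult_0_right matrix_vector_mult_diff_distrib)
         (simp add: matrix_mul_assoc matrix_mult.diff_left matrix_vector_mult_diff_rdistrib)
    ultimately show ?thesis
      unfolding M_def X_def[symmetric] by (simp only: matrix_vector_mul_assoc[symmetric])
  qed
  with dK that show ?thesis by blast
qed

section \<open>The score\<close>

lemma det_orthogonal_sandwich:
  fixes Q X :: "real^'n^'n"
  assumes Q: "orthogonal_matrix Q"
  shows "det (Q ** X ** transpose Q) = det X"
proof -
  have "det Q * det (transpose Q) = 1"
    using orthogonal_matrix_mult(1)[OF Q] by (metis det_I det_mul)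
  then show ?thesis by (simp add: det_mul mult_ac)
qed

lemma det_mexp:
  fixes A :: "real^'n^'n"
  assumes "transpose A = A"
  shows "det (mexp A) = exp (A \<bullet> mat 1)"
proof -
  obtain Q lam where Q: "orthogonal_matrix Q" and e: "A = Q ** mdiag lam ** transpose Q"
    by (rule symmetric_matrix_diagonalization[OF assms])
  have "det (mexp A) = (\<Prod>i\<in>UNIV. exp (lam $ i))"
    unfolding e mexp_diagonalized[OF Q] det_orthogonal_sandwich[OF Q]
    by (subst det_diagonal) auto
  also have "\<dots> = exp (mdiag lam \<bullet> mat 1)"
    by (simp add: exp_sum inner_mat_1)
  also have "mdiag lam \<bullet> mat 1 = A \<bullet> mat 1"
    by (simp add: e inner_sandwich orthogonal_matrix_mult[OF Q])
  finally show ?thesis .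
qed

lemma matrix_inv_eqI:
  fixes A B :: "real^'n^'n"
  assumes "A ** B = mat 1"
  shows "matrix_inv A = B"
proof -
  have "invertible A" using assms invertible_right_inverse by blast
  from matrix_inv_mult(2)[OF this] show ?thesis
    using assms by (metis matrix_mul_assoc matrix_mul_lid matrix_mul_rid)
qed

lemma sandwich_mdiag_mult:
  assumes Q: "orthogonal_matrix Q"
  shows "(Q ** mdiag u ** transpose Q) ** (Q ** mdiag v ** transpose Q) = Q ** mdiag (\<chi> i. u $ i * v $ i) ** transpose Q"
proof -
  have "mdiag u ** mdiag v = mdiag (\<chi> i. u $ i * v $ i)"
    by (simp add: vec_eq_iff)
  then have "Q ** mdiag u ** mdiag v = Q ** mdiag (\<chi> i. u $ i * v $ i)"
    by (simp add: matrix_mul_assoc[symmetric])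
  then show ?thesis
    by (simp add: matrix_mul_assoc orthogonal_matrix_cancel[OF Q])
qed

lemma minus_sandwich_mdiag: "- (Q ** mdiag lam ** transpose Q) = Q ** mdiag (- lam) ** transpose Q"
proof -
  have "mdiag (- lam) = - mdiag lam" by (simp add: vec_eq_iff)
  then show ?thesis by (simp add: matrix_mult.minus_left matrix_mult.minus_right)
qed

lemma matrix_inv_mexp:
  fixes A :: "real^'n^'n"
  assumes "transpose A = A"
  shows "matrix_inv (mexp A) = mexp (- A)"
proof (rule matrix_inv_eqI)
  obtain Q lam where Q: "orthogonal_matrix Q" and e: "A = Q ** mdiag lam ** transpose Q"
    by (rule symmetric_matrix_diagonalization[OF assms])
  have "mdiag (\<chi> i. exp (lam $ i) * exp (- lam $ i)) = mat 1"
    by (simp add: vec_eq_iff mat_def exp_minus)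
  then show "mexp A ** mexp (- A) = mat 1"
    unfolding e minus_sandwich_mdiag mexp_diagonalized[OF Q] sandwich_mdiag_mult[OF Q]
    by (simp add: orthogonal_matrix_mult[OF Q])
qed

lemma dk_delta_minus: "dk_delta (- a) (- b) = exp (- a) * dk_delta a b * exp (- b)"
proof (cases "a = b")
  case False
  have "(exp (- a) - exp (- b)) * (a - b) = exp (- a) * (exp a - exp b) * exp (- b) * (b - a)"
    by (simp add: exp_minus field_simps)
  with False show ?thesis by (simp add: dk_delta_def divide_simps)
qed (simp add: dk_delta_def mult.commute exp_minus)

text \<open>The rule d(C^-1) = -C^-1 dC C^-1 for C^-1 = mexp (-A). The minus sign sits in the
  direction, since A moving along H means -A moving along -H.\<close>

lemma dexp_minus:
  fixes Q :: "real^'n^'n" and lam :: "real^'n"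
  assumes Q: "orthogonal_matrix Q"
  defines "Ci \<equiv> mexp (- (Q ** mdiag lam ** transpose Q))"
  shows "dexp Q (- lam) H = Ci ** dexp Q lam H ** Ci"
proof -
  let ?D = "mdiag (\<chi> i. exp (- lam $ i))"
  let ?X = "hadamard (\<chi> i j. dk_delta (lam $ i) (lam $ j)) (transpose Q ** H ** Q)"
  have Ci: "Ci = Q ** ?D ** transpose Q"
    unfolding Ci_def minus_sandwich_mdiag mexp_diagonalized[OF Q] by simp
  have "hadamard (\<chi> i j. dk_delta ((- lam) $ i) ((- lam) $ j)) (transpose Q ** H ** Q) = ?D ** ?X ** ?D"
    by (simp add: vec_eq_iff dk_delta_minus mult_ac)
  then show ?thesis
    unfolding dexp_def Ci by (simp add: matrix_mul_assoc orthogonal_matrix_cancel[OF Q])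
qed

text \<open>The rule d ln det C = tr (C^-1 dC), which must agree with tr dA because ln det C = tr
  A.\<close>

lemma dexp_inner_inverse:
  fixes Q :: "real^'n^'n" and lam :: "real^'n"
  assumes Q: "orthogonal_matrix Q"
  shows "dexp Q lam H \<bullet> mexp (- (Q ** mdiag lam ** transpose Q)) = H \<bullet> mat 1"
proof -
  have "hadamard (\<chi> i j. dk_delta (lam $ i) (lam $ j)) (mdiag (\<chi> i. exp (- lam $ i))) = mat 1"
    by (auto simp: vec_eq_iff mat_def dk_delta_def exp_minus)
  then have "dexp Q lam (mexp (- (Q ** mdiag lam ** transpose Q))) = mat 1"
    unfolding minus_sandwich_mdiag mexp_diagonalized[OF Q] dexp_def
    by (simp add: matrix_mul_assoc orthogonal_matrix_cancel[OF Q] orthogonal_matrix_mult[OF Q])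
  then show ?thesis by (simp add: dexp_self_adjoint)
qed

lemma inner_outer: "X \<bullet> outer z z = z \<bullet> (X *v z)"
  by (simp add: inner_vec_def outer_def matrix_vector_mult_def sum_distrib_left mult_ac)

text \<open>Working with the logarithm A of the scale matrix turns derivatives of \<open>det\<close>
  and \<open>matrix_inv\<close> into those of a trace and of \<open>mexp (- A)\<close>. The family A
  is arbitrary, so its derivative K stays abstract.\<close>

lemma has_derivative_ln_tstd_density:
  fixes A :: "'a::real_normed_vector \<Rightarrow> real^'n^'n" and Q :: "real^'n^'n" and lam z :: "real^'n"
    and \<nu> :: real and \<gamma> :: 'a
  assumes nu: "\<nu> > 2" and sym: "\<And>g. transpose (A g) = A g"
    and der: "(A has_derivative K) (at \<gamma>)"
    and Q: "orthogonal_matrix Q" and A: "A \<gamma> = Q ** mdiag lam ** transpose Q"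
  defines "C \<equiv> mexp (A \<gamma>)"
  defines "Ci \<equiv> matrix_inv C"
  defines "W \<equiv> (\<nu> + real CARD('n)) / (\<nu> - 2 + z \<bullet> (Ci *v z))"
  shows "((\<lambda>g. ln (tstd_density \<nu> (mexp (A g)) z)) has_derivative
    (\<lambda>h. (1/2) * ((kron Ci Ci *v (W *\<^sub>R vecm (outer z z) - vecm C)) \<bullet> vecm (dexp Q lam (K h))))) (at \<gamma>)"
proof -
  define k where "k = Gamma ((\<nu> + real CARD('n)) / 2) / Gamma (\<nu> / 2)
     * ((\<nu> - 2) * pi) powr (- real CARD('n) / 2)"
  have k: "k > 0"
    unfolding k_def using nu
    by (intro mult_pos_pos divide_pos_pos Gamma_real_pos) (auto intro!: add_pos_nonneg)
  have symm: "transpose (- A g) = - A g" for g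
    using sym[of g] by (simp add: vec_eq_iff transpose_def)
  define q where "q g = z \<bullet> (mexp (- A g) *v z)" for g
  have q0: "q g \<ge> 0" for g
    unfolding q_def using mexp_positive_definite[OF symm, of z g] by (cases "z = 0") auto
  \<comment> \<open>The determinant contributes a term linear in A; positivity of all factors lets
    ln split.\<close>
  have ln_eq: "ln (tstd_density \<nu> (mexp (A g)) z) =
      ln k - (1/2) * (A g \<bullet> mat 1) - ((\<nu> + real CARD('n)) / 2) * ln (1 + (1 / (\<nu> - 2)) * q g)" for g
  proof -
    have pos: "1 + (1 / (\<nu> - 2)) * q g > 0"
      using q0[of g] nu by (intro add_pos_nonneg mult_nonneg_nonneg) auto
    have "tstd_density \<nu> (mexp (A g)) z =
        k * exp (A g \<bullet> mat 1) powr (-1/2) * (1 + (1 / (\<nu> - 2)) * q g) powr (- (\<nu> + real CARD('n)) / 2)"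
      by (simp add: tstd_density_def k_def det_mexp[OF sym] matrix_inv_mexp[OF sym] q_def)
    also have "ln \<dots> = ln k + (-1/2) * (A g \<bullet> mat 1) + (- (\<nu> + real CARD('n)) / 2) * ln (1 + (1 / (\<nu> - 2)) * q g)"
      using k pos by (subst ln_mult_pos ln_powr; simp)+
    finally show ?thesis by (simp add: minus_divide_left[symmetric] mult_minus_left del: minus_divide_left minus_add_distrib)
  qed
  have mA: "- A \<gamma> = Q ** mdiag (- lam) ** transpose Q"
    by (simp add: A minus_sandwich_mdiag)
  have Ci: "Ci = mexp (- A \<gamma>)"
    by (simp add: Ci_def C_def matrix_inv_mexp[OF sym])
  have CiT: "transpose Ci = Ci"
    by (simp add: Ci mexp_symmetric[OF symm])
  have CiC: "Ci ** C = mat 1"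
    unfolding Ci_def
    by (rule matrix_inv_mult) (simp add: C_def invertible_det_nz det_mexp[OF sym])
  have dmexp: "((\<lambda>g. mexp (- A g)) has_derivative (\<lambda>h. dexp Q (- lam) (- K h))) (at \<gamma>)"
    by (rule has_derivative_compose[OF has_derivative_minus[OF der]])
       (use has_derivative_mexp[OF Q, of "- lam"] mA in simp)
  have dq: "(q has_derivative (\<lambda>h. dexp Q (- lam) (- K h) \<bullet> outer z z)) (at \<gamma>)"
    using has_derivative_inner_left[OF dmexp, of "outer z z"] by (simp add: q_def[abs_def] inner_outer)
  have dq_eq: "dexp Q (- lam) (- K h) \<bullet> outer z z = - ((Ci ** outer z z ** Ci) \<bullet> dexp Q lam (K h))" for h
  proof -
    have "dexp Q (- lam) (- K h) = - dexp Q (- lam) (K h)"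
      using has_derivative_linear[OF has_derivative_mexp[OF Q]] by (rule linear_neg)
    also have "\<dots> \<bullet> outer z z = - ((Ci ** dexp Q lam (K h) ** transpose Ci) \<bullet> outer z z)"
      unfolding dexp_minus[OF Q] by (simp add: Ci A[symmetric] CiT[unfolded Ci])
    also have "\<dots> = - ((Ci ** outer z z ** Ci) \<bullet> dexp Q lam (K h))"
      using inner_sandwich[of Ci "dexp Q lam (K h)" "outer z z"]
      by (simp only: CiT) (simp only: inner_commute[of "Ci ** outer z z ** Ci"])
    finally show ?thesis .
  qed
  have pos: "1 + (1 / (\<nu> - 2)) * q \<gamma> > 0"
    using q0[of \<gamma>] nu by (intro add_pos_nonneg mult_nonneg_nonneg) auto
  \<comment> \<open>Dividing through by \<nu> - 2 brings W into the shape that the chain rule for ln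
    produces.\<close>
  have W: "W = (\<nu> + real CARD('n)) * (1 / (\<nu> - 2)) / (1 + (1 / (\<nu> - 2)) * q \<gamma>)"
    using nu q0[of \<gamma>] by (simp add: W_def q_def Ci divide_simps)
  have "((\<lambda>g. ln (tstd_density \<nu> (mexp (A g)) z)) has_derivative
      (\<lambda>h. - (1/2) * (K h \<bullet> mat 1) - ((\<nu> + real CARD('n)) / 2) *
        ((1 / (\<nu> - 2)) * (dexp Q (- lam) (- K h) \<bullet> outer z z) / (1 + (1 / (\<nu> - 2)) * q \<gamma>)))) (at \<gamma>)"
  proof -
    have "((\<lambda>g. 1 + (1 / (\<nu> - 2)) * q g) has_derivative
        (\<lambda>h. (1 / (\<nu> - 2)) * (dexp Q (- lam) (- K h) \<bullet> outer z z))) (at \<gamma>)"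
      using has_derivative_add[OF has_derivative_const has_derivative_mult_right[OF dq], of 1 "1 / (\<nu> - 2)"]
      by (simp only: add_0_left)
    moreover have "(ln has_derivative (\<lambda>t. t / (1 + (1 / (\<nu> - 2)) * q \<gamma>))) (at (1 + (1 / (\<nu> - 2)) * q \<gamma>))"
    proof -
      have "(*) (1 / y) = (\<lambda>t. t / y)" for y :: real by (simp add: fun_eq_iff)
      then show ?thesis using DERIV_ln_divide[OF pos] by (simp only: has_field_derivative_def)
    qed
    ultimately have "((\<lambda>g. ln (1 + (1 / (\<nu> - 2)) * q g)) has_derivative
        (\<lambda>h. (1 / (\<nu> - 2)) * (dexp Q (- lam) (- K h) \<bullet> outer z z) / (1 + (1 / (\<nu> - 2)) * q \<gamma>))) (at \<gamma>)"
      by (rule has_derivative_compose)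
    from has_derivative_diff[OF has_derivative_diff[OF has_derivative_const
        has_derivative_mult_right[OF has_derivative_inner_left[OF der]]] has_derivative_mult_right[OF this]]
    show ?thesis unfolding ln_eq by (simp only: diff_0 mult_minus_left)
  qed
  moreover have "- (1/2) * (K h \<bullet> mat 1) - ((\<nu> + real CARD('n)) / 2) *
        ((1 / (\<nu> - 2)) * (dexp Q (- lam) (- K h) \<bullet> outer z z) / (1 + (1 / (\<nu> - 2)) * q \<gamma>)) =
      (1/2) * ((kron Ci Ci *v (W *\<^sub>R vecm (outer z z) - vecm C)) \<bullet> vecm (dexp Q lam (K h)))" for h
  proof -
    have "W *\<^sub>R vecm (outer z z) - vecm C = vecm (W *\<^sub>R outer z z - C)"
      by (simp add: vec_eq_iff)
    then have "kron Ci Ci *v (W *\<^sub>R vecm (outer z z) - vecm C) = vecm (Ci ** (W *\<^sub>R outer z z - C) ** Ci)"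
      by (simp add: kron_vecm CiT)
    also have "Ci ** (W *\<^sub>R outer z z - C) ** Ci = W *\<^sub>R (Ci ** outer z z ** Ci) - Ci"
      by (simp add: matrix_mult.diff_left matrix_mult.diff_right matrix_mult.scaleR_left
          matrix_mult.scaleR_right CiC)
    finally have "(kron Ci Ci *v (W *\<^sub>R vecm (outer z z) - vecm C)) \<bullet> vecm (dexp Q lam (K h)) =
        W * ((Ci ** outer z z ** Ci) \<bullet> dexp Q lam (K h)) - Ci \<bullet> dexp Q lam (K h)"
      by (simp add: vecm_inner inner_diff_left)
    also have "Ci \<bullet> dexp Q lam (K h) = K h \<bullet> mat 1"
      using dexp_inner_inverse[OF Q, of lam "K h"] by (simp add: Ci A inner_commute)
    finally have R: "(kron Ci Ci *v (W *\<^sub>R vecm (outer z z) - vecm C)) \<bullet> vecm (dexp Q lam (K h)) =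
        W * ((Ci ** outer z z ** Ci) \<bullet> dexp Q lam (K h)) - K h \<bullet> mat 1" .
    show ?thesis
      unfolding R dq_eq unfolding W by (simp add: right_diff_distrib)
  qed
  ultimately show ?thesis by (simp only:)
qed

section \<open>Lebesgue measure under linear maps\<close>

text \<open>The library proves invariance of Lebesgue measure under orthogonal maps only for
  well-ordered index types, so the index type is replaced by a well-ordered copy of itself.\<close>

typedef 'a wo_copy = "UNIV :: 'a set"
  by auto

lemma wo_copy_bij: "bij (Rep_wo_copy :: 'a wo_copy \<Rightarrow> 'a)"
  by (rule bij_betw_byWitness[where f'=Abs_wo_copy]) (auto simp: Abs_wo_copy_inverse Rep_wo_copy_inverse)

text \<open>Any injection into the natural numbers serves, since the order pulled back along it is a
  well-order.\<close>

definition wo_rank :: "'a::finite wo_copy \<Rightarrow> nat" where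
  "wo_rank x = (SOME f. inj f) (Rep_wo_copy x)"

lemma inj_wo_rank: "inj wo_rank"
proof -
  have "\<exists>f :: 'a \<Rightarrow> nat. inj f"
    using finite_imp_inj_to_nat_seg[of "UNIV :: 'a set"] by auto
  then have "inj (SOME f :: 'a \<Rightarrow> nat. inj f)"
    by (rule someI_ex)
  then show ?thesis
    unfolding wo_rank_def[abs_def] using wo_copy_bij inj_compose[of _ Rep_wo_copy]
    by (auto simp: bij_def o_def)
qed

instance wo_copy :: (finite) finite
proof
  show "finite (UNIV :: 'a wo_copy set)"
    using wo_copy_bij[where 'a='a] by (metis bij_betw_finite finite)
qed

instantiation wo_copy :: (finite) wellorder
begin

definition less_eq_wo_copy :: "'a wo_copy \<Rightarrow> 'a wo_copy \<Rightarrow> bool" where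
  "less_eq_wo_copy x y \<longleftrightarrow> wo_rank x \<le> wo_rank y"

definition less_wo_copy :: "'a wo_copy \<Rightarrow> 'a wo_copy \<Rightarrow> bool" where
  "less_wo_copy x y \<longleftrightarrow> wo_rank x < wo_rank y"

instance
proof
  fix x y :: "'a wo_copy"
  assume "x \<le> y" "y \<le> x"
  then show "x = y"
    using inj_wo_rank by (auto simp: less_eq_wo_copy_def dest: injD)
next
  fix P :: "'a wo_copy \<Rightarrow> bool" and a :: "'a wo_copy"
  assume step: "\<And>x. (\<And>y. y < x \<Longrightarrow> P y) \<Longrightarrow> P x"
  show "P a"
    by (induction a rule: measure_induct_rule[where f=wo_rank]) (auto intro: step simp: less_wo_copy_def)
qed (auto simp: less_eq_wo_copy_def less_wo_copy_def)

end

lemma prod_Basis_cart: "(\<Prod>b\<in>(Basis :: (real^'n) set). g b) = (\<Prod>i\<in>UNIV. g (axis i 1))"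
proof -
  have B: "(Basis :: (real^'n) set) = range (\<lambda>i. axis i 1)"
    by (auto simp: Basis_vec_def)
  have "inj (\<lambda>i. axis i (1::real) :: real^'n)"
    by (auto simp: inj_def axis_eq_axis)
  then show ?thesis
    unfolding B by (simp add: prod.reindex)
qed

text \<open>Relabelling coordinates carries boxes to boxes with the same side lengths in another
  order, and Lebesgue measure is determined by boxes.\<close>

lemma distr_lborel_reindex:
  fixes \<phi> :: "real^'n \<Rightarrow> real^'m" and r :: "'m \<Rightarrow> 'n"
  assumes r: "bij r"
  defines "\<phi> \<equiv> \<lambda>x. \<chi> i. x $ r i"
  shows "distr lborel borel \<phi> = lborel"
proof (rule lborel_eqI[symmetric])
  have "continuous_on UNIV \<phi>"
    unfolding \<phi>_def by (intro continuous_on_vec_lambda continuous_intros)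
  then have meas: "\<phi> \<in> borel \<rightarrow>\<^sub>M borel" by (rule borel_measurable_continuous_onI)
  fix l u :: "real^'m"
  assume le: "\<And>b. b \<in> Basis \<Longrightarrow> l \<bullet> b \<le> u \<bullet> b"
  define s where "s = inv r"
  have rs: "r (s i) = i" for i using r by (simp add: s_def bij_def surj_f_inv_f)
  have sr: "s (r i) = i" for i using r by (simp add: s_def bij_def)
  let ?l = "\<chi> i. l $ s i" and ?u = "\<chi> i. u $ s i"
  have le': "l $ i \<le> u $ i" for i
    using le[of "axis i 1"] by (simp add: inner_axis axis_in_Basis_iff)
  have "\<phi> -` box l u = box ?l ?u"
    unfolding \<phi>_def by (auto simp: mem_box_cart) (metis rs, metis rs, metis sr, metis sr)
  then have "emeasure (distr lborel borel \<phi>) (box l u) = emeasure lborel (box ?l ?u)"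
    using meas by (simp add: emeasure_distr)
  also have "\<dots> = (\<Prod>b\<in>Basis. (?u - ?l) \<bullet> b)"
    using le' by (subst emeasure_lborel_box) (auto simp: Basis_vec_def inner_axis)
  also have "(\<Prod>b\<in>Basis. (?u - ?l) \<bullet> b) = (\<Prod>i\<in>UNIV. u $ s i - l $ s i)"
    by (simp add: prod_Basis_cart inner_axis)
  also have "\<dots> = (\<Prod>i\<in>UNIV. u $ i - l $ i)"
    using r by (intro prod.reindex_bij_betw[of s UNIV UNIV "\<lambda>i. u $ i - l $ i"]) (simp add: s_def bij_imp_bij_inv)
  also have "\<dots> = (\<Prod>b\<in>Basis. (u - l) \<bullet> b)"
    by (simp add: prod_Basis_cart inner_axis)
  finally show "emeasure (distr lborel borel \<phi>) (box l u) = (\<Prod>b\<in>Basis. (u - l) \<bullet> b)" .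
qed simp

lemma distr_lborel_orthogonal_wellorder:
  fixes f :: "real^'n::{finite,wellorder} \<Rightarrow> real^'n::_"
  assumes f: "orthogonal_transformation f"
  shows "distr lborel borel f = lborel"
proof (rule lborel_eqI[symmetric])
  have lin: "linear f" using f orthogonal_transformation_linear by blast
  then have meas: "f \<in> borel \<rightarrow>\<^sub>M borel"
    by (intro borel_measurable_continuous_onI linear_continuous_on linear_conv_bounded_linear[THEN iffD1])
  fix l u :: "real^'n::_"
  assume le: "\<And>b. b \<in> Basis \<Longrightarrow> l \<bullet> b \<le> u \<bullet> b"
  have bij: "bij f" using f by (rule orthogonal_transformation_bij)
  have vim: "f -` box l u = inv f ` box l u"
    using bij by (rule bij_vimage_eq_inv_image)
  have inv: "orthogonal_transformation (inv f)"
    using f by (rule orthogonal_transformation_inv)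
  have lm: "inv f ` box l u \<in> lmeasurable"
    by (rule measurable_orthogonal_image[OF inv]) simp
  have bs: "inv f ` box l u \<in> sets borel"
    using measurable_sets[OF meas, of "box l u"] vim by simp
  have "emeasure lborel (inv f ` box l u) = emeasure lebesgue (inv f ` box l u)"
    using bs by simp
  also have "\<dots> = ennreal (measure lebesgue (inv f ` box l u))"
    using lm by (simp add: emeasure_eq_measure2)
  also have "measure lebesgue (inv f ` box l u) = measure lebesgue (box l u)"
    by (rule measure_orthogonal_image[OF inv]) simp
  also have "ennreal (measure lebesgue (box l u)) = (\<Prod>b\<in>Basis. (u - l) \<bullet> b)"
    using le by (simp add: measure_lborel_box_eq)
  finally have "emeasure lborel (inv f ` box l u) = (\<Prod>b\<in>Basis. (u - l) \<bullet> b)" .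
  then show "emeasure (distr lborel borel f) (box l u) = (\<Prod>b\<in>Basis. (u - l) \<bullet> b)"
    using meas by (simp add: emeasure_distr vim)
qed simp

theorem distr_lborel_orthogonal:
  fixes f :: "real^'n \<Rightarrow> real^'n"
  assumes f: "orthogonal_transformation f"
  shows "distr lborel borel f = lborel"
proof -
  define \<phi> :: "real^'n \<Rightarrow> real^('n wo_copy)" where "\<phi> = (\<lambda>x. \<chi> i. x $ Rep_wo_copy i)"
  define \<psi> :: "real^('n wo_copy) \<Rightarrow> real^'n" where "\<psi> = (\<lambda>x. \<chi> i. x $ Abs_wo_copy i)"
  have \<phi>\<psi>: "\<phi> (\<psi> x) = x" and \<psi>\<phi>: "\<psi> (\<phi> y) = y" for x y
    by (simp_all add: \<phi>_def \<psi>_def vec_eq_iff Rep_wo_copy_inverse Abs_wo_copy_inverse)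
  have bijA: "bij (Abs_wo_copy :: 'n \<Rightarrow> _)"
    by (rule bij_betw_byWitness[where f'=Rep_wo_copy]) (auto simp: Abs_wo_copy_inverse Rep_wo_copy_inverse)
  have d\<phi>: "distr lborel borel \<phi> = lborel"
    unfolding \<phi>_def by (rule distr_lborel_reindex[OF wo_copy_bij])
  have d\<psi>: "distr lborel borel \<psi> = lborel"
    unfolding \<psi>_def by (rule distr_lborel_reindex[OF bijA])
  have lin\<phi>: "linear \<phi>" and lin\<psi>: "linear \<psi>"
    by (auto intro!: linearI simp: \<phi>_def \<psi>_def vec_eq_iff)
  have lin: "linear f" using f orthogonal_transformation_linear by blast
  have inner\<phi>: "\<phi> x \<bullet> \<phi> y = x \<bullet> y" for x y
    using sum.reindex_bij_betw[OF wo_copy_bij, of "\<lambda>i. x $ i * y $ i"] by (simp add: \<phi>_def inner_vec_def)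
  have inner\<psi>: "\<psi> x \<bullet> \<psi> y = x \<bullet> y" for x y
    using inner\<phi>[of "\<psi> x" "\<psi> y"] by (simp add: \<phi>\<psi>)
  \<comment> \<open>Conjugation by the relabelling keeps inner products, so the result for
    well-ordered indices applies to the conjugate of f.\<close>
  have g: "orthogonal_transformation (\<phi> \<circ> f \<circ> \<psi>)"
    using f lin lin\<phi> lin\<psi> unfolding orthogonal_transformation_def
    by (auto simp: inner\<phi> inner\<psi> intro!: linear_compose)
  have m: "\<phi> \<in> borel \<rightarrow>\<^sub>M borel" "\<psi> \<in> borel \<rightarrow>\<^sub>M borel" "f \<in> borel \<rightarrow>\<^sub>M borel"
    using lin lin\<phi> lin\<psi>
    by (auto intro!: borel_measurable_continuous_onI linear_continuous_on simp: linear_conv_bounded_linear)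
  then have mg: "\<phi> \<circ> f \<circ> \<psi> \<in> borel \<rightarrow>\<^sub>M borel"
    by (auto intro!: measurable_comp)
  have "distr lborel borel f = distr lborel borel (\<psi> \<circ> (\<phi> \<circ> f \<circ> \<psi>) \<circ> \<phi>)"
    by (simp add: o_def \<psi>\<phi>)
  also have "\<dots> = distr (distr (distr lborel borel \<phi>) borel (\<phi> \<circ> f \<circ> \<psi>)) borel \<psi>"
    using m mg by (simp add: distr_distr measurable_comp o_assoc)
  also have "\<dots> = lborel"
    by (simp add: d\<phi> d\<psi> distr_lborel_orthogonal_wellorder[OF g])
  finally show ?thesis .
qed

text \<open>The map is an orthogonal one after a coordinatewise scaling. The first preserves
  Lebesgue measure, so the Jacobian is the product of the scale factors alone.\<close>

lemma has_bochner_integral_lborel_linear: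
  fixes f :: "real^'n \<Rightarrow> 'b::{banach, second_countable_topology}"
  assumes [measurable]: "f \<in> borel_measurable borel"
    and Q: "orthogonal_matrix Q" and c: "\<And>i. c $ i \<noteq> 0"
    and I: "has_bochner_integral lborel (\<lambda>u. (\<Prod>i\<in>UNIV. \<bar>c $ i\<bar>) *\<^sub>R f ((Q ** mdiag c) *v u)) I"
  shows "has_bochner_integral lborel f I"
proof -
  have ot: "orthogonal_transformation ((*v) Q)"
    using Q by (simp add: orthogonal_transformation_matrix matrix_vector_mul_linear)
  have Qm [measurable]: "(*v) Q \<in> borel \<rightarrow>\<^sub>M borel"
    by (intro borel_measurable_continuous_onI linear_continuous_on matrix_vector_mul_bounded_linear)
  define T :: "real^'n \<Rightarrow> real^'n" where "T u = mdiag c *v u" for u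
  have Tm [measurable]: "T \<in> borel \<rightarrow>\<^sub>M borel"
    unfolding T_def
    by (intro borel_measurable_continuous_onI linear_continuous_on matrix_vector_mul_bounded_linear)
  define c' where "c' b = c \<bullet> b" for b :: "real^'n"
  have T: "0 + (\<Sum>j\<in>Basis. (c' j * (u \<bullet> j)) *\<^sub>R j) = T u" for u
  proof (rule euclidean_eqI)
    fix b :: "real^'n" assume "b \<in> Basis"
    then show "(0 + (\<Sum>j\<in>Basis. (c' j * (u \<bullet> j)) *\<^sub>R j)) \<bullet> b = T u \<bullet> b"
      by (auto simp: inner_sum_left inner_Basis Basis_vec_def inner_axis T_def c'_def matrix_vector_mult_def
          if_distrib if_distribR cong: if_cong)
  qed
  have c'0: "j \<in> Basis \<Longrightarrow> c' j \<noteq> 0" for j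
    using c by (auto simp: c'_def Basis_vec_def inner_axis)
  have "(lborel :: (real^'n) measure) = density (distr lborel borel T) (\<lambda>_. (\<Prod>j\<in>Basis. \<bar>c' j\<bar>))"
    using lborel_affine_euclidean[of c' 0, OF c'0] by (simp only: T)
  also have "(\<Prod>j\<in>Basis. \<bar>c' j\<bar>) = (\<Prod>i\<in>UNIV. \<bar>c $ i\<bar>)"
    by (simp add: prod_Basis_cart c'_def inner_axis)
  finally have lb: "(lborel :: (real^'n) measure) = density (distr lborel borel T) (\<lambda>_. ennreal (\<Prod>i\<in>UNIV. \<bar>c $ i\<bar>))" .
  have "has_bochner_integral (density (distr lborel borel T) (\<lambda>_. ennreal (\<Prod>i\<in>UNIV. \<bar>c $ i\<bar>))) (\<lambda>u. f (Q *v u)) I"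
    using I by (intro has_bochner_integral_density has_bochner_integral_distr)
      (auto simp: T_def matrix_vector_mul_assoc prod_nonneg intro!: measurable_compose[OF Qm])
  then have "has_bochner_integral lborel (\<lambda>u. f (Q *v u)) I"
    unfolding lb[symmetric] .
  then have "has_bochner_integral (distr lborel borel ((*v) Q)) f I"
    by (intro has_bochner_integral_distr) auto
  then show ?thesis by (simp only: distr_lborel_orthogonal[OF ot])
qed

section \<open>Moments of the spherical Student kernel\<close>

text \<open>The moment of order 2k of a centred Gaussian with variance 1/2, that is, (2k-1)!! /
  2^k.\<close>

definition gauss_ratio :: "nat \<Rightarrow> real" where
  "gauss_ratio k = fact (2 * k) / (2 ^ (2 * k) * fact k)"

lemma gauss_ratio_simps [simp]:
  "gauss_ratio 0 = 1" "gauss_ratio (Suc 0) = 1/2" "gauss_ratio 1 = 1/2" "gauss_ratio 2 = 3/4"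
  by (simp_all add: gauss_ratio_def fact_numeral)

definition gauss_moment :: "nat \<Rightarrow> real" where
  "gauss_moment k = sqrt pi * gauss_ratio k"

lemma gauss_ratio_nonneg: "gauss_ratio k \<ge> 0"
  by (simp add: gauss_ratio_def)

lemma gauss_moment_nonneg: "gauss_moment k \<ge> 0"
  by (simp add: gauss_moment_def gauss_ratio_nonneg)

lemma nn_integral_gauss_moment:
  assumes t: "t > 0"
  shows "(\<integral>\<^sup>+x. ennreal (x ^ (2 * k) * exp (- t * x\<^sup>2)) \<partial>lborel) =
    ennreal (gauss_moment k * t powr (- (real k + 1/2)))"
proof -
  have "has_bochner_integral lborel (\<lambda>x::real. exp (- x\<^sup>2) * x ^ (2 * k)) (gauss_moment k)"
    using has_bochner_integral_even_function[OF gaussian_moment_even_pos[where k=k]]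
    by (simp add: gauss_moment_def gauss_ratio_def)
  then have "(\<integral>\<^sup>+x. ennreal (exp (- x\<^sup>2) * x ^ (2 * k)) \<partial>lborel) = ennreal (gauss_moment k)"
    by (subst nn_integral_eq_integral) (auto simp: has_bochner_integral_iff)
  also have "(\<integral>\<^sup>+x. ennreal (exp (- x\<^sup>2) * x ^ (2 * k)) \<partial>lborel) =
      ennreal \<bar>sqrt t\<bar> * (\<integral>\<^sup>+x. ennreal (exp (- (0 + sqrt t * x)\<^sup>2) * (0 + sqrt t * x) ^ (2 * k)) \<partial>lborel)"
    using t by (intro nn_integral_real_affine) auto
  also have "(\<integral>\<^sup>+x. ennreal (exp (- (0 + sqrt t * x)\<^sup>2) * (0 + sqrt t * x) ^ (2 * k)) \<partial>lborel) =
      (\<integral>\<^sup>+x. ennreal (t ^ k) * ennreal (x ^ (2 * k) * exp (- t * x\<^sup>2)) \<partial>lborel)"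
  proof (rule nn_integral_cong)
    fix x :: real
    have "sqrt t ^ (2 * k) = t ^ k" using t by (simp add: power_mult)
    then have "exp (- (0 + sqrt t * x)\<^sup>2) * (0 + sqrt t * x) ^ (2 * k) = t ^ k * (x ^ (2 * k) * exp (- t * x\<^sup>2))"
      using t by (simp add: power_mult_distrib)
    then show "ennreal (exp (- (0 + sqrt t * x)\<^sup>2) * (0 + sqrt t * x) ^ (2 * k)) =
        ennreal (t ^ k) * ennreal (x ^ (2 * k) * exp (- t * x\<^sup>2))"
      using t by (simp only: ennreal_mult'[of "t ^ k", OF zero_le_power[OF less_imp_le]])
  qed
  also have "\<dots> = ennreal (t ^ k) * (\<integral>\<^sup>+x. ennreal (x ^ (2 * k) * exp (- t * x\<^sup>2)) \<partial>lborel)"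
    by (rule nn_integral_cmult) simp
  finally have e: "ennreal (sqrt t * t ^ k) * (\<integral>\<^sup>+x. ennreal (x ^ (2 * k) * exp (- t * x\<^sup>2)) \<partial>lborel) =
      ennreal (gauss_moment k)"
    using t by (simp add: ennreal_mult mult_ac)
  have pw: "t powr (real k + 1/2) = sqrt t * t ^ k"
    using t by (simp add: powr_add powr_realpow powr_half_sqrt mult.commute)
  \<comment> \<open>The finite positive factor is cancelled by multiplying with its reciprocal while
    the integral is still an extended nonnegative real.\<close>
  have c: "t powr (- (real k + 1/2)) * (sqrt t * t ^ k) = 1"
    using t unfolding pw[symmetric] by (simp add: powr_add[symmetric])
  have "ennreal (t powr (- (real k + 1/2))) * (ennreal (sqrt t * t ^ k) * (\<integral>\<^sup>+x. ennreal (x ^ (2 * k) * exp (- t * x\<^sup>2)) \<partial>lborel)) =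
      ennreal (t powr (- (real k + 1/2))) * ennreal (gauss_moment k)"
    unfolding e ..
  moreover have "ennreal (t powr (- (real k + 1/2))) * ennreal (sqrt t * t ^ k) = 1"
    using t c by (subst ennreal_mult[symmetric]) auto
  ultimately show ?thesis
    by (simp add: mult.assoc[symmetric] ennreal_mult[symmetric] gauss_moment_nonneg mult.commute)
qed

lemma nn_integral_gauss_moment_cart:
  fixes k :: "'n::finite \<Rightarrow> nat"
  assumes t: "t > 0"
  shows "(\<integral>\<^sup>+u. ennreal ((\<Prod>i\<in>UNIV. (u $ i) ^ (2 * k i)) * exp (- t * (u \<bullet> u))) \<partial>lborel) =
    ennreal ((\<Prod>i\<in>UNIV. gauss_moment (k i)) * t powr (- (real CARD('n) / 2 + real (\<Sum>i\<in>UNIV. k i))))"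
proof -
  \<comment> \<open>The product formula for integrals ranges over \<open>Basis\<close>; idx returns
    the coordinate that a basis vector belongs to.\<close>
  define idx where "idx b = (THE i. b = (axis i 1 :: real^'n))" for b
  have idx: "idx (axis i 1) = i" for i
    unfolding idx_def by (auto simp: axis_eq_axis)
  let ?f = "\<lambda>b x. ennreal (x ^ (2 * k (idx b)) * exp (- t * x\<^sup>2))"
  have "ennreal ((\<Prod>i\<in>UNIV. (u $ i) ^ (2 * k i)) * exp (- t * (u \<bullet> u))) = (\<Prod>b\<in>Basis. ?f b (u \<bullet> b))" for u :: "real^'n"
  proof -
    have "exp (- t * (u \<bullet> u)) = (\<Prod>i\<in>UNIV. exp (- t * (u $ i)\<^sup>2))"
      by (simp add: exp_sum[symmetric] inner_vec_def sum_distrib_left sum_negf power2_eq_square)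
    then show ?thesis
      by (simp add: prod_Basis_cart idx inner_axis prod_ennreal prod.distrib[symmetric])
  qed
  then have "(\<integral>\<^sup>+u. ennreal ((\<Prod>i\<in>UNIV. (u $ i) ^ (2 * k i)) * exp (- t * (u \<bullet> u))) \<partial>lborel) =
      (\<integral>\<^sup>+u. (\<Prod>b\<in>(Basis::(real^'n) set). ?f b (u \<bullet> b)) \<partial>lborel)"
    by simp
  also have "\<dots> = (\<Prod>b\<in>(Basis::(real^'n) set). \<integral>\<^sup>+x. ?f b x \<partial>lborel)"
    by (rule nn_integral_lborel_prod) auto
  also have "\<dots> = (\<Prod>i\<in>(UNIV::'n set). ennreal (gauss_moment (k i) * t powr (- (real (k i) + 1/2))))"
    by (simp only: prod_Basis_cart idx nn_integral_gauss_moment[OF t])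
  also have "\<dots> = ennreal (\<Prod>i\<in>(UNIV::'n set). gauss_moment (k i) * t powr (- (real (k i) + 1/2)))"
    by (rule prod_ennreal) (simp add: gauss_moment_nonneg)
  also have "(\<Prod>i\<in>(UNIV::'n set). gauss_moment (k i) * t powr (- (real (k i) + 1/2))) =
      (\<Prod>i\<in>UNIV. gauss_moment (k i)) * t powr (\<Sum>i\<in>UNIV. - (real (k i) + 1/2))"
    using t by (simp add: prod.distrib powr_sum)
  also have "(\<Sum>i\<in>(UNIV::'n set). - (real (k i) + 1/2)) = - (real CARD('n) / 2 + real (\<Sum>i\<in>UNIV. k i))"
    by (simp add: sum_negf sum_subtractf)
  finally show ?thesis .
qed

lemma nn_integral_Gamma_scaled:
  assumes "s > 0" "a > (0::real)"
  shows "(\<integral>\<^sup>+t. ennreal (indicator {0..} t * t powr (s - 1) * exp (- a * t)) \<partial>lborel) =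
    ennreal (Gamma s * a powr (- s))"
proof -
  have "ennreal (Gamma s) = (\<integral>\<^sup>+t. ennreal (indicator {0..} t * t powr (s - 1) / exp t) \<partial>lborel)"
    by (rule Gamma_conv_nn_integral_real[OF assms(1)])
  also have "\<dots> = ennreal \<bar>a\<bar> * (\<integral>\<^sup>+t. ennreal (indicator {0..} (0 + a * t) * (0 + a * t) powr (s - 1) / exp (0 + a * t)) \<partial>lborel)"
    using assms by (intro nn_integral_real_affine) auto
  also have "(\<integral>\<^sup>+t. ennreal (indicator {0..} (0 + a * t) * (0 + a * t) powr (s - 1) / exp (0 + a * t)) \<partial>lborel) =
      (\<integral>\<^sup>+t. ennreal (a powr (s - 1)) * ennreal (indicator {0..} t * t powr (s - 1) * exp (- a * t)) \<partial>lborel)"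
    using assms
    by (intro nn_integral_cong, subst ennreal_mult[symmetric])
       (auto simp: indicator_def zero_le_mult_iff powr_mult exp_minus divide_inverse)
  also have "\<dots> = ennreal (a powr (s - 1)) * (\<integral>\<^sup>+t. ennreal (indicator {0..} t * t powr (s - 1) * exp (- a * t)) \<partial>lborel)"
    by (rule nn_integral_cmult) simp
  finally have e: "ennreal (Gamma s) = ennreal (a powr s) * (\<integral>\<^sup>+t. ennreal (indicator {0..} t * t powr (s - 1) * exp (- a * t)) \<partial>lborel)"
    using assms by (simp add: mult.assoc[symmetric] ennreal_mult[symmetric] powr_diff)
  have "ennreal (a powr (- s)) * ennreal (Gamma s) =
      (ennreal (a powr (- s)) * ennreal (a powr s)) * (\<integral>\<^sup>+t. ennreal (indicator {0..} t * t powr (s - 1) * exp (- a * t)) \<partial>lborel)"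
    unfolding e by (simp add: mult.assoc)
  also have "ennreal (a powr (- s)) * ennreal (a powr s) = 1"
    using assms by (subst ennreal_mult[symmetric]) (auto simp: powr_add[symmetric])
  finally show ?thesis
    using assms Gamma_real_pos[of s] by (simp add: ennreal_mult[symmetric] mult.commute less_imp_le)
qed

text \<open>The Student kernel is a Gamma mixture of Gaussian kernels:
  \<open>\<Gamma>(s) (1 + |u|\<^sup>2)\<^sup>-\<^sup>s = \<integral> t\<^sup>s\<^sup>-\<^sup>1 exp (-t) exp (-t |u|\<^sup>2) dt\<close>.\<close>
lemma nn_integral_student_moment:
  fixes k :: "'n::finite \<Rightarrow> nat" and s :: real
  assumes s: "s > real CARD('n) / 2 + real (\<Sum>i\<in>UNIV. k i)"
  shows "(\<integral>\<^sup>+u. ennreal ((\<Prod>i\<in>UNIV. (u $ i) ^ (2 * k i)) * (1 + u \<bullet> u) powr (- s)) \<partial>lborel) =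
    ennreal ((\<Prod>i\<in>UNIV. gauss_moment (k i)) *
      (Gamma (s - real CARD('n) / 2 - real (\<Sum>i\<in>UNIV. k i)) / Gamma s))"
proof -
  define P where "P u = (\<Prod>i\<in>UNIV. (u $ i) ^ (2 * k i))" for u :: "real^'n"
  define e where "e = real CARD('n) / 2 + real (\<Sum>i\<in>UNIV. k i)"
  define g where "g t = indicator {0..} t * t powr (s - 1) * exp (- t)" for t :: real
  have e0: "e \<ge> 0" unfolding e_def by (intro add_nonneg_nonneg) (auto intro: sum_nonneg)
  have s0: "s > 0" "s > e" using s e0 by (simp_all add: e_def)
  have P0: "P u \<ge> 0" for u
    unfolding P_def by (intro prod_nonneg) simp
  have g0: "g t \<ge> 0" for t by (simp add: g_def)
  have [measurable]: "P \<in> borel_measurable borel"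
    unfolding P_def[abs_def] by (intro borel_measurable_continuous_onI continuous_intros)
  have [measurable]: "g \<in> borel_measurable borel"
    unfolding g_def by measurable
  let ?c = "\<Prod>i\<in>UNIV. gauss_moment (k i)"
  have c0: "?c \<ge> 0" by (intro prod_nonneg) (simp add: gauss_moment_nonneg)
  have "ennreal (Gamma s) * (\<integral>\<^sup>+u. ennreal (P u * (1 + u \<bullet> u) powr (- s)) \<partial>lborel) =
      (\<integral>\<^sup>+u. ennreal (P u) * ennreal (Gamma s * (1 + u \<bullet> u) powr (- s)) \<partial>lborel)"
    using Gamma_real_pos[OF s0(1)]
    by (subst nn_integral_cmult[symmetric])
       (auto simp: ennreal_mult[symmetric] P0 mult_ac less_imp_le intro!: nn_integral_cong)
  also have "\<dots> = (\<integral>\<^sup>+u. ennreal (P u) * (\<integral>\<^sup>+t. ennreal (indicator {0..} t * t powr (s - 1) * exp (- (1 + u \<bullet> u) * t)) \<partial>lborel) \<partial>lborel)"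
    by (intro nn_integral_cong, subst nn_integral_Gamma_scaled[OF s0(1)]) (auto intro!: add_pos_nonneg)
  also have "\<dots> = (\<integral>\<^sup>+u. \<integral>\<^sup>+t. ennreal (g t) * ennreal (P u * exp (- t * (u \<bullet> u))) \<partial>lborel \<partial>lborel)"
    by (intro nn_integral_cong, subst nn_integral_cmult[symmetric])
       (auto simp: ennreal_mult[symmetric] P0 g0 g_def exp_add[symmetric] algebra_simps intro!: nn_integral_cong)
  \<comment> \<open>Nonnegativity allows the exchange before anything is known about
    integrability.\<close>
  also have "\<dots> = (\<integral>\<^sup>+t. \<integral>\<^sup>+u. ennreal (g t) * ennreal (P u * exp (- t * (u \<bullet> u))) \<partial>lborel \<partial>lborel)"
    by (rule lborel_pair.Fubini'[symmetric]) measurable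
  also have "\<dots> = (\<integral>\<^sup>+t. ennreal ?c * ennreal (indicator {0..} t * t powr ((s - e) - 1) * exp (- 1 * t)) \<partial>lborel)"
  proof (rule nn_integral_cong)
    fix t :: real
    have "(\<integral>\<^sup>+u. ennreal (g t) * ennreal (P u * exp (- t * (u \<bullet> u))) \<partial>lborel) =
        ennreal (g t) * (\<integral>\<^sup>+u. ennreal (P u * exp (- t * (u \<bullet> u))) \<partial>lborel)"
      by (rule nn_integral_cmult) measurable
    also have "\<dots> = ennreal ?c * ennreal (indicator {0..} t * t powr ((s - e) - 1) * exp (- 1 * t))"
    proof (cases "t > 0")
      case True
      have "t powr (s - 1) * t powr (- e) = t powr ((s - e) - 1)"
        by (simp add: powr_add[symmetric] algebra_simps)
      then show ?thesis
        unfolding P_def nn_integral_gauss_moment_cart[OF True] e_def[symmetric] using True c0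
        by (simp add: g_def ennreal_mult[symmetric] mult_ac)
    next
      case False
      \<comment> \<open>At t = 0 the inner integral is not Gaussian, but both sides vanish because
        \<open>0 powr x = 0\<close>.\<close>
      then have "t < 0 \<or> t = 0" by auto
      then show ?thesis by (auto simp: g_def)
    qed
    finally show "(\<integral>\<^sup>+u. ennreal (g t) * ennreal (P u * exp (- t * (u \<bullet> u))) \<partial>lborel) =
      ennreal ?c * ennreal (indicator {0..} t * t powr ((s - e) - 1) * exp (- 1 * t))" .
  qed
  also have "\<dots> = ennreal ?c * (\<integral>\<^sup>+t. ennreal (indicator {0..} t * t powr ((s - e) - 1) * exp (- 1 * t)) \<partial>lborel)"
    by (rule nn_integral_cmult) measurable
  also have "(\<integral>\<^sup>+t. ennreal (indicator {0..} t * t powr ((s - e) - 1) * exp (- 1 * t)) \<partial>lborel) = ennreal (Gamma (s - e))"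
    using s0 by (subst nn_integral_Gamma_scaled) auto
  finally have eq: "ennreal (Gamma s) * (\<integral>\<^sup>+u. ennreal (P u * (1 + u \<bullet> u) powr (- s)) \<partial>lborel) =
      ennreal (?c * Gamma (s - e))"
    using c0 Gamma_real_pos[of "s - e"] s0 by (simp add: ennreal_mult)
  have "ennreal (1 / Gamma s) * (ennreal (Gamma s) * (\<integral>\<^sup>+u. ennreal (P u * (1 + u \<bullet> u) powr (- s)) \<partial>lborel)) =
      ennreal (1 / Gamma s) * ennreal (?c * Gamma (s - e))"
    unfolding eq ..
  moreover have "ennreal (1 / Gamma s) * ennreal (Gamma s) = 1"
    using Gamma_real_pos[OF s0(1)] by (subst ennreal_mult[symmetric]) auto
  ultimately have "(\<integral>\<^sup>+u. ennreal (P u * (1 + u \<bullet> u) powr (- s)) \<partial>lborel) =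
      ennreal (?c * (Gamma (s - e) / Gamma s))"
    using c0 Gamma_real_pos[of "s - e"] Gamma_real_pos[OF s0(1)] s0
    by (simp add: mult.assoc[symmetric] ennreal_mult[symmetric] less_imp_le)
  then show ?thesis
    by (simp add: P_def e_def diff_diff_eq)
qed

text \<open>The integral of \<open>(1 + u \<bullet> u) powr (- s)\<close> over real^'n for s > n/2;
  the type argument carries the dimension.\<close>

definition student_mass :: "'n::finite itself \<Rightarrow> real \<Rightarrow> real" where
  "student_mass _ s = sqrt pi ^ CARD('n) * (Gamma (s - real CARD('n) / 2) / Gamma s)"

text \<open>Raising the exponent to s + m for a monomial of degree 2m keeps the numerator at Gamma
  (s - n/2), so every moment is an explicit multiple of the total mass.\<close>

lemma has_bochner_integral_student_moment:
  fixes k :: "'n::finite \<Rightarrow> nat" and s :: real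
  assumes s: "s > real CARD('n) / 2" and K: "(\<Sum>i\<in>UNIV. k i) = m"
  shows "has_bochner_integral lborel
    (\<lambda>u :: real^'n. (\<Prod>i\<in>UNIV. (u $ i) ^ (2 * k i)) * (1 + u \<bullet> u) powr (- (s + real m)))
    ((\<Prod>i\<in>UNIV. gauss_ratio (k i)) * student_mass TYPE('n) s * (Gamma s / Gamma (s + real m)))"
proof (rule has_bochner_integral_nn_integral)
  have s0: "s > 0" using s by (meson divide_nonneg_nonneg le_less_trans of_nat_0_le_iff zero_le_numeral)
  show "AE u in lborel. 0 \<le> (\<Prod>i\<in>UNIV. (u $ i) ^ (2 * k i)) * (1 + u \<bullet> u) powr (- (s + real m))"
    by (intro AE_I2 mult_nonneg_nonneg prod_nonneg) auto
  show "0 \<le> (\<Prod>i\<in>UNIV. gauss_ratio (k i)) * student_mass TYPE('n) s * (Gamma s / Gamma (s + real m))"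
    unfolding student_mass_def using s s0
    by (intro mult_nonneg_nonneg prod_nonneg divide_nonneg_nonneg) (auto intro!: Gamma_real_nonneg gauss_ratio_nonneg)
  have "(\<Prod>i\<in>(UNIV::'n set). gauss_moment (k i)) * (Gamma (s + real m - real CARD('n) / 2 - real m) / Gamma (s + real m)) =
    (\<Prod>i\<in>UNIV. gauss_ratio (k i)) * student_mass TYPE('n) s * (Gamma s / Gamma (s + real m))"
    using Gamma_real_pos[OF s0] by (simp add: gauss_moment_def student_mass_def prod.distrib mult_ac)
  then show "(\<integral>\<^sup>+u. ennreal ((\<Prod>i\<in>UNIV. (u $ i) ^ (2 * k i)) * (1 + u \<bullet> u) powr (- (s + real m))) \<partial>lborel) =
    ennreal ((\<Prod>i\<in>UNIV. gauss_ratio (k i)) * student_mass TYPE('n) s * (Gamma s / Gamma (s + real m)))"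
    using nn_integral_student_moment[of k "s + real m", unfolded K] s by (simp only: add_strict_right_mono)
qed measurable

lemma prod_of_bool_power:
  fixes f :: "'n::finite \<Rightarrow> 'a::comm_monoid_mult"
  shows "(\<Prod>m\<in>UNIV. f m ^ (2 * of_bool (m = i))) = f i ^ 2"
proof -
  have "(\<Prod>m\<in>UNIV. f m ^ (2 * of_bool (m = i))) = (\<Prod>m\<in>UNIV. if m = i then f m ^ 2 else 1)"
    by (intro prod.cong) auto
  then show ?thesis by simp
qed

lemma abs_mult_le_sum_squares: "\<bar>x * y\<bar> \<le> x\<^sup>2 + (y::real)\<^sup>2"
proof -
  have "2 * (\<bar>x\<bar> * \<bar>y\<bar>) \<le> x\<^sup>2 + y\<^sup>2"
    using sum_squares_bound[of "\<bar>x\<bar>" "\<bar>y\<bar>"] by (simp add: mult.assoc)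
  moreover have "0 \<le> \<bar>x\<bar> * \<bar>y\<bar>" by simp
  ultimately show ?thesis unfolding abs_mult by linarith
qed

text \<open>Flipping the sign of one coordinate is orthogonal, so the integral equals its own
  negative. Integrability has to be known beforehand.\<close>

lemma has_bochner_integral_reflection_odd:
  fixes f :: "real^'n \<Rightarrow> real"
  assumes f: "integrable lborel f"
    and odd: "\<And>u. f (\<chi> m. if m = a then - u $ m else u $ m) = - f u"
  shows "has_bochner_integral lborel f 0"
proof -
  let ?R = "\<lambda>u :: real^'n. \<chi> m. if m = a then - u $ m else u $ m"
  have lin: "linear ?R" by (rule linearI) (auto simp: vec_eq_iff)
  have "?R u \<bullet> ?R v = u \<bullet> v" for u v :: "real^'n"
    unfolding inner_vec_def by (intro sum.cong) auto
  with lin have "orthogonal_transformation ?R"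
    by (simp add: orthogonal_transformation_def)
  then have d: "distr lborel borel ?R = lborel" by (rule distr_lborel_orthogonal)
  have m: "?R \<in> borel \<rightarrow>\<^sub>M borel"
    using lin by (intro borel_measurable_continuous_onI linear_continuous_on) (simp add: linear_conv_bounded_linear)
  have fm: "f \<in> borel_measurable borel" using f by auto
  have "integral\<^sup>L lborel f = integral\<^sup>L (distr lborel borel ?R) f" by (simp only: d)
  also have "\<dots> = (\<integral>u. f (?R u) \<partial>lborel)"
    using m fm by (intro integral_distr) auto
  also have "\<dots> = - integral\<^sup>L lborel f"
    using f by (simp add: odd)
  finally have "integral\<^sup>L lborel f = 0" by simp
  with f show ?thesis by (simp add: has_bochner_integral_iff)
qed

text \<open>If the four indices cannot be matched in pairs, some value a occurs an odd number of
  times, and flipping the sign of coordinate a negates the monomial.\<close>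

lemma unpaired_index_has_odd_multiplicity:
  fixes i j k l :: 'a
  assumes "\<not> (i = j \<and> k = l \<or> i = k \<and> j = l \<or> i = l \<and> j = k)"
  obtains a where "(if i = a then - 1 else 1) * (if j = a then - 1 else 1) *
    (if k = a then - 1 else 1) * (if l = a then - 1 else 1) = (- 1 :: real)"
proof -
  consider "i = j" "k = i" "l \<noteq> i" | "i = j" "k \<noteq> i" "k \<noteq> l" | "i \<noteq> j" "i = k" "j \<noteq> l"
    | "i \<noteq> j" "i = l" "j \<noteq> k" | "i \<noteq> j" "i \<noteq> k" "i \<noteq> l"
    using assms by auto
  then show ?thesis
  proof cases
    case 1 then show ?thesis by (intro that[of l]) auto
  next
    case 2 then show ?thesis by (intro that[of k]) auto
  next
    case 3 then show ?thesis by (intro that[of j]) auto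
  next
    case 4 then show ?thesis by (intro that[of j]) auto
  next
    case 5 then show ?thesis by (intro that[of i]) auto
  qed
qed

text \<open>A vector is the sum of bounded linear images of its entries. Applied twice, this reduces
  matrix-valued integrals to entries.\<close>

lemma has_bochner_integral_vecI:
  fixes f :: "'a \<Rightarrow> ('b::euclidean_space, 'c::finite) vec"
  assumes "\<And>i. has_bochner_integral M (\<lambda>x. f x $ i) (I $ i)"
  shows "has_bochner_integral M f I"
proof -
  have ax: "v = (\<Sum>i\<in>UNIV. axis i (v $ i))" for v :: "('b, 'c) vec"
    by (simp add: vec_eq_iff axis_def if_distrib cong: if_cong)
  have bl: "bounded_linear (axis i :: 'b \<Rightarrow> ('b, 'c) vec)" for i
    unfolding linear_conv_bounded_linear[symmetric]
    by (rule linearI) (auto simp: vec_eq_iff axis_def)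
  have "has_bochner_integral M (\<lambda>x. \<Sum>i\<in>UNIV. axis i (f x $ i)) (\<Sum>i\<in>UNIV. axis i (I $ i))"
    by (intro has_bochner_integral_sum has_bochner_integral_bounded_linear[OF bl] assms)
  then show ?thesis unfolding ax[symmetric] .
qed

section \<open>Mixed moments of degree two and four\<close>

context
  fixes s :: real and J :: real
  assumes s: "s > real CARD('n::finite) / 2"
  defines "J \<equiv> student_mass TYPE('n) s"
begin

lemma student_exponent_pos: "s > 0"
  using s by (meson divide_nonneg_nonneg le_less_trans of_nat_0_le_iff zero_le_numeral)

lemma student_moment_0:
  "has_bochner_integral lborel (\<lambda>u :: real^'n. (1 + u \<bullet> u) powr (- s)) J"
  using has_bochner_integral_student_moment[OF s, of "\<lambda>_. 0" 0] Gamma_real_pos[OF student_exponent_pos]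
  by (simp add: J_def)

lemma student_moment_2_even:
  "has_bochner_integral lborel (\<lambda>u :: real^'n. (u $ i)\<^sup>2 * (1 + u \<bullet> u) powr (- (s + 1))) (J / (2 * s))"
proof -
  let ?k = "\<lambda>m. of_bool (m = i) :: nat"
  have "(\<Prod>m\<in>UNIV. gauss_ratio (?k m)) = (\<Prod>m\<in>UNIV. if m = i then 1/2 else (1::real))"
    by (intro prod.cong) (auto simp: numeral_2_eq_2[symmetric])
  then have r: "(\<Prod>m\<in>UNIV. gauss_ratio (?k m)) = (1/2 :: real)"
    by simp
  have "Gamma (s + 1) = s * Gamma s" using student_exponent_pos by (intro Gamma_plus1) auto
  then have G: "Gamma s / Gamma (s + 1) = 1 / s" using Gamma_real_pos[OF student_exponent_pos] by simp
  have v: "1 / 2 * J * (1 / s) = J / (2 * s)" by simp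
  have "(\<Sum>m\<in>UNIV. ?k m) = 1" by (simp add: of_bool_def)
  from has_bochner_integral_student_moment[OF s this] show ?thesis
    unfolding of_nat_1 prod_of_bool_power r G J_def[symmetric] v .
qed

lemma student_moment_4_even:
  "has_bochner_integral lborel (\<lambda>u :: real^'n. (u $ i)\<^sup>2 * (u $ j)\<^sup>2 * (1 + u \<bullet> u) powr (- (s + 2)))
    ((if i = j then 3 else 1) * J / (4 * s * (s + 1)))"
proof -
  let ?k = "\<lambda>m. of_bool (m = i) + of_bool (m = j) :: nat"
  \<comment> \<open>If i = j, one coordinate carries exponent 2 and its whole value 3/4 is charged
    to the first factor; otherwise two coordinates contribute 1/2 each. Hence the ratio 3 to
    1.\<close>
  have "(\<Prod>m\<in>UNIV. gauss_ratio (?k m)) =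
      (\<Prod>m\<in>UNIV. (if m = i then (if i = j then 3/4 else 1/2) else (1::real)) * (if m = j then (if i = j then 1 else 1/2) else 1))"
    by (intro prod.cong) (auto simp: numeral_2_eq_2[symmetric])
  then have r: "(\<Prod>m\<in>UNIV. gauss_ratio (?k m)) = (if i = j then 3 else 1) / (4 :: real)"
    by (simp add: prod.distrib)
  have "Gamma (s + 2) = (s + 1) * (s * Gamma s)"
  proof -
    have "x \<notin> \<int>\<^sub>\<le>\<^sub>0" if "x > 0" for x :: real
      using that by (auto elim!: nonpos_Ints_cases)
    then show ?thesis
      using student_exponent_pos Gamma_plus1[of s] Gamma_plus1[of "s + 1"] by (simp add: add.assoc)
  qed
  then have G: "Gamma s / Gamma (s + 2) = 1 / (s * (s + 1))"
    using Gamma_real_pos[OF student_exponent_pos] by (simp add: mult_ac)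
  have p: "(\<Prod>m\<in>UNIV. (u $ m) ^ (2 * ?k m)) = (u $ i)\<^sup>2 * (u $ j)\<^sup>2" for u :: "real^'n"
    unfolding distrib_left power_add prod.distrib prod_of_bool_power ..
  have v: "x / 4 * J * (1 / (s * (s + 1))) = x * J / (4 * s * (s + 1))" for x
    by simp
  have "(\<Sum>m\<in>UNIV. ?k m) = 2" by (simp add: of_bool_def sum.distrib)
  from has_bochner_integral_student_moment[OF s this] show ?thesis
    unfolding of_nat_numeral p r G J_def[symmetric] v .
qed

lemma student_moment_2:
  "has_bochner_integral lborel (\<lambda>u :: real^'n. u $ i * u $ j * (1 + u \<bullet> u) powr (- (s + 1)))
    (of_bool (i = j) * (J / (2 * s)))"
proof (cases "i = j")
  case True
  then show ?thesis using student_moment_2_even[of i] by (simp add: power2_eq_square)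
next
  case False
  have int: "integrable lborel (\<lambda>u :: real^'n. u $ i * u $ j * (1 + u \<bullet> u) powr (- (s + 1)))"
  proof (rule Bochner_Integration.integrable_bound)
    show "integrable lborel (\<lambda>u :: real^'n. (u $ i)\<^sup>2 * (1 + u \<bullet> u) powr (- (s + 1)) + (u $ j)\<^sup>2 * (1 + u \<bullet> u) powr (- (s + 1)))"
      using student_moment_2_even by (intro Bochner_Integration.integrable_add) (auto simp: has_bochner_integral_iff)
    show "AE u in lborel. norm (u $ i * u $ j * (1 + u \<bullet> u) powr (- (s + 1)))
        \<le> norm ((u $ i)\<^sup>2 * (1 + u \<bullet> u) powr (- (s + 1)) + (u $ j)\<^sup>2 * (1 + u \<bullet> u) powr (- (s + 1)))"
    proof (rule AE_I2)
      fix u :: "real^'n"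
      have "\<bar>u $ i * u $ j\<bar> * (1 + u \<bullet> u) powr (- (s + 1)) \<le> ((u $ i)\<^sup>2 + (u $ j)\<^sup>2) * (1 + u \<bullet> u) powr (- (s + 1))"
        by (rule mult_right_mono[OF abs_mult_le_sum_squares]) simp
      then show "norm (u $ i * u $ j * (1 + u \<bullet> u) powr (- (s + 1)))
        \<le> norm ((u $ i)\<^sup>2 * (1 + u \<bullet> u) powr (- (s + 1)) + (u $ j)\<^sup>2 * (1 + u \<bullet> u) powr (- (s + 1)))"
        by (simp add: abs_mult distrib_right[symmetric])
    qed
  qed measurable
  have "has_bochner_integral lborel (\<lambda>u :: real^'n. u $ i * u $ j * (1 + u \<bullet> u) powr (- (s + 1))) 0"
  proof (rule has_bochner_integral_reflection_odd[OF int, of i])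
    fix u :: "real^'n"
    let ?v = "\<chi> m. if m = i then - u $ m else u $ m"
    have "?v \<bullet> ?v = u \<bullet> u" unfolding inner_vec_def by (intro sum.cong) auto
    then show "?v $ i * ?v $ j * (1 + ?v \<bullet> ?v) powr (- (s + 1)) = - (u $ i * u $ j * (1 + u \<bullet> u) powr (- (s + 1)))"
      using False by simp
  qed
  with False show ?thesis by simp
qed

text \<open>A Wick formula: the coefficient counts the pairings of the four indices, which gives 3
  when all coincide.\<close>

lemma student_moment_4:
  "has_bochner_integral lborel (\<lambda>u :: real^'n. u $ i * u $ j * u $ k * u $ l * (1 + u \<bullet> u) powr (- (s + 2)))
    ((of_bool (i = j \<and> k = l) + of_bool (i = k \<and> j = l) + of_bool (i = l \<and> j = k)) * (J / (4 * s * (s + 1))))"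
proof (cases "i = j \<and> k = l \<or> i = k \<and> j = l \<or> i = l \<and> j = k")
  case True
  have e: "has_bochner_integral lborel f (c * (J / (4 * s * (s + 1))))"
    if "f = (\<lambda>u :: real^'n. u $ i * u $ i * u $ k * u $ k * (1 + u \<bullet> u) powr (- (s + 2)))"
      and "c = (if i = k then 3 else 1)" for i k f c
    using student_moment_4_even[of i k] unfolding that by (simp add: power2_eq_square mult_ac)
  from True show ?thesis
  proof (elim disjE conjE)
    assume "i = j" "k = l"
    then show ?thesis by (intro e[of _ i k]) auto
  next
    assume "i = k" "j = l"
    then show ?thesis by (intro e[of _ i j]) (auto simp: fun_eq_iff)
  next
    assume "i = l" "j = k"
    then show ?thesis by (intro e[of _ i j]) (auto simp: fun_eq_iff)
  qed
next
  case False
  let ?f = "\<lambda>u :: real^'n. u $ i * u $ j * u $ k * u $ l * (1 + u \<bullet> u) powr (- (s + 2))"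
  have int: "integrable lborel ?f"
  proof (rule Bochner_Integration.integrable_bound)
    \<comment> \<open>Grouping the monomial as a product of two quadratic factors bounds it by the
      sum of their squares, whose integrals are known even moments.\<close>
    let ?g = "\<lambda>u :: real^'n. (u $ i)\<^sup>2 * (u $ j)\<^sup>2 * (1 + u \<bullet> u) powr (- (s + 2)) + (u $ k)\<^sup>2 * (u $ l)\<^sup>2 * (1 + u \<bullet> u) powr (- (s + 2))"
    show "integrable lborel ?g"
      using student_moment_4_even by (intro Bochner_Integration.integrable_add) (auto simp: has_bochner_integral_iff)
    show "AE u in lborel. norm (?f u) \<le> norm (?g u)"
    proof (rule AE_I2)
      fix u :: "real^'n"
      from abs_mult_le_sum_squares[of "u $ i * u $ j" "u $ k * u $ l"]
      have "\<bar>u $ i * u $ j * u $ k * u $ l\<bar> \<le> (u $ i)\<^sup>2 * (u $ j)\<^sup>2 + (u $ k)\<^sup>2 * (u $ l)\<^sup>2"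
        by (simp add: power_mult_distrib mult_ac)
      then have "\<bar>u $ i * u $ j * u $ k * u $ l\<bar> * (1 + u \<bullet> u) powr (- (s + 2)) \<le>
          ((u $ i)\<^sup>2 * (u $ j)\<^sup>2 + (u $ k)\<^sup>2 * (u $ l)\<^sup>2) * (1 + u \<bullet> u) powr (- (s + 2))"
        by (rule mult_right_mono) simp
      then show "norm (?f u) \<le> norm (?g u)"
        by (simp add: abs_mult distrib_right[symmetric])
    qed
  qed measurable
  obtain a where a: "(if i = a then - 1 else 1) * (if j = a then - 1 else 1) *
    (if k = a then - 1 else 1) * (if l = a then - 1 else 1) = (- 1 :: real)"
    using unpaired_index_has_odd_multiplicity[OF False] by blast
  have "has_bochner_integral lborel ?f 0"
  proof (rule has_bochner_integral_reflection_odd[OF int, of a])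
    fix u :: "real^'n"
    let ?v = "\<chi> m. if m = a then - u $ m else u $ m"
    have v: "?v $ m = (if m = a then - 1 else 1) * u $ m" for m by simp
    have "?v \<bullet> ?v = u \<bullet> u" unfolding inner_vec_def by (intro sum.cong) auto
    moreover have "?v $ i * ?v $ j * ?v $ k * ?v $ l =
        ((if i = a then - 1 else 1) * (if j = a then - 1 else 1) * (if k = a then - 1 else 1) * (if l = a then - 1 else 1)) *
        (u $ i * u $ j * u $ k * u $ l)"
      unfolding v by (simp only: mult_ac)
    ultimately show "?f ?v = - ?f u"
      unfolding a by simp
  qed
  moreover have "\<not> (i = j \<and> k = l)" "\<not> (i = k \<and> j = l)" "\<not> (i = l \<and> j = k)"
    using False by blast+
  then have "of_bool (i = j \<and> k = l) + of_bool (i = k \<and> j = l) + of_bool (i = l \<and> j = k) = (0::real)"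
    by (simp only: of_bool_eq add_0)
  ultimately show ?thesis by (simp only: mult_zero_left)
qed

text \<open>After expansion each pairing carries 4 s^2 / (4 s (s+1)) = s/(s+1). For the pairing
  (ij)(kl) the two cross terms subtract 1 each and the constant term adds 1, leaving s/(s+1) -
  1.\<close>

lemma student_information_entry:
  fixes i j k l :: 'n
  shows "has_bochner_integral lborel
    (\<lambda>u :: real^'n. (1 + u \<bullet> u) powr (- s) *
      ((2 * s / (1 + u \<bullet> u) * (u $ i * u $ j) - of_bool (i = j)) * (2 * s / (1 + u \<bullet> u) * (u $ k * u $ l) - of_bool (k = l))))
    (J * (s / (s + 1) * (of_bool (i = k \<and> j = l) + of_bool (i = l \<and> j = k)) + (s / (s + 1) - 1) * of_bool (i = j \<and> k = l)))"
proof -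
  have "has_bochner_integral lborel (\<lambda>u :: real^'n.
      4 * s\<^sup>2 * (u $ i * u $ j * u $ k * u $ l * (1 + u \<bullet> u) powr (- (s + 2)))
      - 2 * s * of_bool (k = l) * (u $ i * u $ j * (1 + u \<bullet> u) powr (- (s + 1)))
      - 2 * s * of_bool (i = j) * (u $ k * u $ l * (1 + u \<bullet> u) powr (- (s + 1)))
      + of_bool (i = j \<and> k = l) * (1 + u \<bullet> u) powr (- s))
    (4 * s\<^sup>2 * ((of_bool (i = j \<and> k = l) + of_bool (i = k \<and> j = l) + of_bool (i = l \<and> j = k)) * (J / (4 * s * (s + 1))))
      - 2 * s * of_bool (k = l) * (of_bool (i = j) * (J / (2 * s)))
      - 2 * s * of_bool (i = j) * (of_bool (k = l) * (J / (2 * s)))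
      + of_bool (i = j \<and> k = l) * J)"
    by (intro has_bochner_integral_add has_bochner_integral_diff has_bochner_integral_mult_right
        student_moment_0 student_moment_2 student_moment_4)
  moreover have "4 * s\<^sup>2 * (u $ i * u $ j * u $ k * u $ l * (1 + u \<bullet> u) powr (- (s + 2)))
      - 2 * s * of_bool (k = l) * (u $ i * u $ j * (1 + u \<bullet> u) powr (- (s + 1)))
      - 2 * s * of_bool (i = j) * (u $ k * u $ l * (1 + u \<bullet> u) powr (- (s + 1)))
      + of_bool (i = j \<and> k = l) * (1 + u \<bullet> u) powr (- s) =
    (1 + u \<bullet> u) powr (- s) *
      ((2 * s / (1 + u \<bullet> u) * (u $ i * u $ j) - of_bool (i = j)) * (2 * s / (1 + u \<bullet> u) * (u $ k * u $ l) - of_bool (k = l)))"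
    for u :: "real^'n"
  proof -
    have pos: "1 + u \<bullet> u > 0" by (intro add_pos_nonneg) auto
    have p1: "(1 + u \<bullet> u) powr (- (s + 1)) = (1 + u \<bullet> u) powr (- s) * (1 / (1 + u \<bullet> u))"
      using pos by (simp add: powr_diff)
    have p2: "(1 + u \<bullet> u) powr (- (s + 2)) = (1 + u \<bullet> u) powr (- s) * (1 / (1 + u \<bullet> u) * (1 / (1 + u \<bullet> u)))"
      using pos by (simp add: powr_diff powr_numeral power2_eq_square)
    define r where "r = 1 / (1 + u \<bullet> u)"
    have r: "2 * s / (1 + u \<bullet> u) = 2 * s * r" by (simp add: r_def)
    show ?thesis
      unfolding p1 p2 r r_def[symmetric]
      by (cases "i = j"; cases "k = l") (simp_all add: algebra_simps power2_eq_square)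
  qed
  moreover have "4 * s\<^sup>2 * ((of_bool (i = j \<and> k = l) + of_bool (i = k \<and> j = l) + of_bool (i = l \<and> j = k)) * (J / (4 * s * (s + 1))))
      - 2 * s * of_bool (k = l) * (of_bool (i = j) * (J / (2 * s)))
      - 2 * s * of_bool (i = j) * (of_bool (k = l) * (J / (2 * s)))
      + of_bool (i = j \<and> k = l) * J =
    J * (s / (s + 1) * (of_bool (i = k \<and> j = l) + of_bool (i = l \<and> j = k)) + (s / (s + 1) - 1) * of_bool (i = j \<and> k = l))"
  proof -
    have e4: "4 * s\<^sup>2 * (x * (J / (4 * s * (s + 1)))) = J * (s / (s + 1)) * x" for x
      using student_exponent_pos by (simp add: power2_eq_square)
    have e2: "2 * s * x * (y * (J / (2 * s))) = J * (x * y)" for x y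
      using student_exponent_pos by simp
    show ?thesis unfolding e4 e2 by (simp add: algebra_simps)
  qed
  ultimately show ?thesis by (simp only:)
qed

text \<open>The pairings (ik)(jl), (il)(jk) and (ij)(kl) are the entries of the identity, of the
  commutation matrix and of vec(I) vec(I)'.\<close>

lemma student_information:
  fixes Y :: "real^'n \<Rightarrow> real^'n^'n"
  defines "Y \<equiv> \<lambda>u. (2 * s / (1 + u \<bullet> u)) *\<^sub>R outer u u - mat 1"
  shows "has_bochner_integral lborel
    (\<lambda>u. ((1 + u \<bullet> u) powr (- s)) *\<^sub>R outer (vecm (Y u)) (vecm (Y u)))
    (J *\<^sub>R ((s / (s + 1)) *\<^sub>R (mat 1 + commat) + (s / (s + 1) - 1) *\<^sub>R outer (vecm (mat 1)) (vecm (mat 1))))"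
proof (intro has_bochner_integral_vecI)
  fix ij kl :: "'n \<times> 'n"
  obtain i j k l where ij: "ij = (i, j)" and kl: "kl = (k, l)" by fastforce
  show "has_bochner_integral lborel
      (\<lambda>u. (((1 + u \<bullet> u) powr (- s)) *\<^sub>R outer (vecm (Y u)) (vecm (Y u))) $ ij $ kl)
      ((J *\<^sub>R ((s / (s + 1)) *\<^sub>R (mat 1 + commat) + (s / (s + 1) - 1) *\<^sub>R outer (vecm (mat 1)) (vecm (mat 1)))) $ ij $ kl)"
    using student_information_entry[of i j k l]
    by (simp add: ij kl Y_def outer_def mat_def commat_def of_bool_def[symmetric] of_bool_conj conj_commute eq_commute mult_ac)
qed

end

section \<open>The information matrix\<close>

lemma outer_matrix_mult:
  fixes P :: "real^'a^'b" and R :: "real^'c^'d"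
  shows "outer (P *v x) (R *v y) = P ** outer x y ** transpose R"
proof -
  have "P ** outer x y = outer (P *v x) y"
    by (simp add: vec_eq_iff matrix_matrix_mult_def matrix_vector_mult_def outer_def sum_distrib_left mult_ac)
  moreover have "outer u y ** transpose R = outer u (R *v y)" for u :: "real^'b"
    by (simp add: vec_eq_iff matrix_matrix_mult_def matrix_vector_mult_def outer_def transpose_def
        sum_distrib_left mult_ac)
  ultimately show ?thesis by simp
qed

lemma outer_scaleR: "outer (a *\<^sub>R x) (b *\<^sub>R y) = (a * b) *\<^sub>R outer x y"
  by (simp add: vec_eq_iff outer_def)

text \<open>Reduces Kronecker identities to identities between n by n matrices through the action on
  \<open>vecm\<close>.\<close>

lemma matrix_eq_vecmI:
  fixes X Y :: "real^('n::finite \<times> 'n)^'m"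
  assumes "\<And>H. X *v vecm H = Y *v vecm H"
  shows "X = Y"
  unfolding matrix_eq using assms by (metis vecm_unvecm)

lemma commat_vecm: "commat *v vecm H = vecm (transpose H)"
  by (simp add: vec_eq_iff matrix_vector_mult_def commat_def transpose_def if_distrib if_distribR cong: if_cong)

lemma kron_mult: "kron P R ** kron P' R' = kron (P ** P') (R ** R')"
  by (rule matrix_eq_vecmI)
     (simp only: matrix_vector_mul_assoc[symmetric] kron_vecm matrix_transpose_mul matrix_mul_assoc)

lemma kron_commat: "kron R R ** commat ** transpose (kron R R) = kron (R ** transpose R) (R ** transpose R) ** commat"
  by (rule matrix_eq_vecmI)
     (simp only: matrix_vector_mul_assoc[symmetric] kron_vecm commat_vecm transpose_kron transpose_transpose
        matrix_transpose_mul matrix_mul_assoc)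

lemma continuous_on_outer:
  fixes f :: "'a::topological_space \<Rightarrow> real^'b" and g :: "'a \<Rightarrow> real^'c"
  assumes "continuous_on S f" "continuous_on S g"
  shows "continuous_on S (\<lambda>x. outer (f x) (g x))"
  unfolding outer_def using assms by (intro continuous_on_vec_lambda continuous_intros)

text \<open>B stands for the transposed Jacobian, whose form is immaterial because the information
  is a congruence transform in B. Measurability of the integrand comes from continuity.\<close>

theorem tstd_information:
  fixes Q :: "real^'n^'n" and lam :: "real^'n" and B :: "real^('n::finite \<times> 'n)^'d"
  assumes nu: "\<nu> > 2" and Q: "orthogonal_matrix Q"
  defines "C \<equiv> mexp (Q ** mdiag lam ** transpose Q)"
  defines "Ci \<equiv> matrix_inv C"
  defines "W \<equiv> \<lambda>z. (\<nu> + real CARD('n)) / (\<nu> - 2 + z \<bullet> (Ci *v z))"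
  defines "\<phi> \<equiv> (\<nu> + real CARD('n)) / (\<nu> + real CARD('n) + 2)"
  defines "score \<equiv> \<lambda>z. (1/2) *\<^sub>R (B ** kron Ci Ci *v (W z *\<^sub>R vecm (outer z z) - vecm C))"
  shows "has_bochner_integral lborel (\<lambda>z. tstd_density \<nu> C z *\<^sub>R outer (score z) (score z))
      ((1/4) *\<^sub>R (B ** (\<phi> *\<^sub>R (kron Ci Ci ** (mat 1 + commat))
              + (\<phi> - 1) *\<^sub>R outer (vecm Ci) (vecm Ci)) ** transpose B))"
proof -
  define s where "s = (\<nu> + real CARD('n)) / 2"
  define a where "a = \<nu> - 2"
  have a: "a > 0" using nu by (simp add: a_def)
  have s: "s > real CARD('n) / 2" using nu by (simp add: s_def)
  have s0: "s > 0" using s student_exponent_pos by blast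
  define J where "J = student_mass TYPE('n) s"
  \<comment> \<open>E x is the power C^x in the eigenbasis.\<close>
  define E where "E = (\<lambda>x. mdiag (\<chi> i. exp (x * lam $ i)) :: real^'n^'n)"
  \<comment> \<open>A square root of the inverse, in the sense that R R' = C^-1.\<close>
  define R where "R = Q ** E (- 1/2)"
  \<comment> \<open>Chosen so that z = Q diag(c) u has z' C^-1 z = a (u \<bullet> u); the base of
    the density becomes \<open>1 + u \<bullet> u\<close>.\<close>
  define c where "c = (\<chi> i. sqrt a * exp (1/2 * lam $ i))"
  define Y where "Y = (\<lambda>u :: real^'n. (2 * s / (1 + u \<bullet> u)) *\<^sub>R outer u u - mat 1)"
  have EE: "E x ** E y = E (x + y)" for x y
    by (simp add: E_def vec_eq_iff exp_add[symmetric] distrib_right)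
  have E0: "E 0 = mat 1" by (simp add: E_def vec_eq_iff mat_def)
  have ET: "transpose (E x) = E x" for x by (simp add: E_def)
  have C: "C = Q ** E 1 ** transpose Q"
    by (simp add: C_def mexp_diagonalized[OF Q] E_def)
  have Ci: "Ci = Q ** E (- 1) ** transpose Q"
    unfolding Ci_def
  proof (rule matrix_inv_eqI)
    have "C ** (Q ** E (- 1) ** transpose Q) = Q ** (E 1 ** E (- 1)) ** transpose Q"
      by (simp add: C matrix_mul_assoc orthogonal_matrix_cancel[OF Q])
    then show "C ** (Q ** E (- 1) ** transpose Q) = mat 1"
      by (simp add: EE E0 orthogonal_matrix_mult[OF Q])
  qed
  have CiT: "transpose Ci = Ci"
    by (simp add: Ci E_def)
  have CiC: "Ci ** C = mat 1"
  proof -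
    have "Ci ** C = Q ** (E (- 1) ** E 1) ** transpose Q"
      by (simp add: C Ci matrix_mul_assoc orthogonal_matrix_cancel[OF Q])
    then show ?thesis by (simp add: EE E0 orthogonal_matrix_mult[OF Q])
  qed
  have RR: "R ** transpose R = Ci"
  proof -
    have "R ** transpose R = Q ** (E (- 1/2) ** E (- 1/2)) ** transpose Q"
      by (simp add: R_def matrix_transpose_mul ET matrix_mul_assoc)
    then show ?thesis by (simp add: EE Ci)
  qed
  have mc: "mdiag c = sqrt a *\<^sub>R E (1/2)"
    by (simp add: c_def E_def vec_eq_iff)
  have Ciz: "Ci *v ((Q ** mdiag c) *v u) = sqrt a *\<^sub>R (R *v u)" for u
  proof -
    have "Ci ** (Q ** mdiag c) = sqrt a *\<^sub>R (Q ** (E (- 1) ** E (1/2)))"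
      by (simp add: Ci mc matrix_mul_assoc orthogonal_matrix_cancel[OF Q] matrix_mult.scaleR_right)
    then show ?thesis
      by (simp only: matrix_vector_mul_assoc EE R_def) (simp add: scaleR_matrix_vector_assoc)
  qed
  have quad: "((Q ** mdiag c) *v u) \<bullet> (Ci *v ((Q ** mdiag c) *v u)) = a * (u \<bullet> u)" for u
  proof -
    have "transpose (Q ** mdiag c) ** R = sqrt a *\<^sub>R mat 1"
    proof -
      have "transpose (Q ** mdiag c) ** R = sqrt a *\<^sub>R (E (1/2) ** (transpose Q ** Q) ** E (- 1/2))"
        by (simp add: R_def mc matrix_transpose_mul matrix_mult.scaleR_left matrix_mult.scaleR_right ET
            matrix_mul_assoc transpose_scalar)
      then show ?thesis by (simp add: orthogonal_matrix_mult[OF Q] EE E0)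
    qed
    then have "((Q ** mdiag c) *v u) \<bullet> (R *v u) = sqrt a * (u \<bullet> u)"
      by (metis dot_lmul_matrix inner_scaleR_right matrix_vector_mul_assoc matrix_vector_mul_lid
          scaleR_matrix_vector_assoc transpose_matrix_vector transpose_transpose)
    then show ?thesis using a by (simp add: Ciz)
  qed
  have score_u: "score ((Q ** mdiag c) *v u) = (1/2) *\<^sub>R ((B ** kron R R) *v vecm (Y u))" for u
  proof -
    define z where "z = (Q ** mdiag c) *v u"
    \<comment> \<open>The factor a contributed by z z' cancels the one in the denominator a (1 +
      |u|^2) of W.\<close>
    have Wz: "W z * a = 2 * s / (1 + u \<bullet> u)"
    proof -
      have "1 + u \<bullet> u > 0" by (intro add_pos_nonneg) auto
      moreover have "W z = 2 * s / (a * (1 + u \<bullet> u))"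
      proof -
        have "\<nu> + real CARD('n) = 2 * s" "\<nu> - 2 + a * (u \<bullet> u) = a * (1 + u \<bullet> u)"
          by (simp_all add: s_def a_def distrib_left)
        then show ?thesis unfolding W_def z_def quad by (simp only:)
      qed
      ultimately show ?thesis using a by simp
    qed
    have "W z *\<^sub>R vecm (outer z z) - vecm C = vecm (W z *\<^sub>R outer z z - C)"
      by (simp add: vec_eq_iff)
    then have "kron Ci Ci *v (W z *\<^sub>R vecm (outer z z) - vecm C) = vecm (Ci ** (W z *\<^sub>R outer z z - C) ** Ci)"
      by (simp add: kron_vecm CiT)
    also have "Ci ** (W z *\<^sub>R outer z z - C) ** Ci = W z *\<^sub>R (Ci ** outer z z ** transpose Ci) - Ci"
      by (simp add: matrix_mult.diff_left matrix_mult.diff_right matrix_mult.scaleR_left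
          matrix_mult.scaleR_right CiC CiT)
    also have "Ci ** outer z z ** transpose Ci = a *\<^sub>R outer (R *v u) (R *v u)"
      unfolding outer_matrix_mult[symmetric] z_def Ciz outer_scaleR using a by simp
    also have "W z *\<^sub>R (a *\<^sub>R outer (R *v u) (R *v u)) - Ci = R ** Y u ** transpose R"
      by (simp add: Wz Y_def outer_matrix_mult matrix_mult.diff_left matrix_mult.diff_right matrix_mult.scaleR_left
          matrix_mult.scaleR_right RR)
    finally have "kron Ci Ci *v (W z *\<^sub>R vecm (outer z z) - vecm C) = kron R R *v vecm (Y u)"
      by (simp add: kron_vecm)
    then show ?thesis
      unfolding score_def z_def[symmetric] by (simp only: matrix_vector_mul_assoc[symmetric])
  qed
  \<comment> \<open>The Jacobian absorbs det C^(-1/2) and the power of a, and the remaining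
    constants are the reciprocal of the mass J.\<close>
  have dens: "(\<Prod>i\<in>UNIV. \<bar>c $ i\<bar>) * tstd_density \<nu> C ((Q ** mdiag c) *v u) = (1 / J) * (1 + u \<bullet> u) powr (- s)" for u
  proof -
    have e1: "(\<Prod>i\<in>UNIV. \<bar>c $ i\<bar>) = sqrt a ^ CARD('n) * exp (\<Sum>i\<in>UNIV. 1/2 * lam $ i)"
      using a by (simp add: c_def abs_mult prod.distrib exp_sum)
    have "det C = exp (\<Sum>i\<in>UNIV. lam $ i)"
      unfolding C det_orthogonal_sandwich[OF Q] by (subst det_diagonal) (auto simp: E_def exp_sum)
    then have e2: "det C powr (-1/2) = exp (- (\<Sum>i\<in>UNIV. 1/2 * lam $ i))"
      by (simp add: powr_def sum_divide_distrib[symmetric])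
    have e3: "(a * pi) powr (- real CARD('n) / 2) = 1 / (sqrt a ^ CARD('n) * sqrt pi ^ CARD('n))"
    proof -
      have "(a * pi) powr (- real CARD('n) / 2) = 1 / ((a * pi) powr (1/2)) powr (real CARD('n))"
        by (simp add: powr_powr powr_minus_divide)
      then show ?thesis
        using a by (simp add: powr_half_sqrt powr_realpow real_sqrt_mult power_mult_distrib)
    qed
    have e4: "- (\<nu> + real CARD('n)) / 2 = - s" "\<nu> / 2 = s - real CARD('n) / 2" "(\<nu> + real CARD('n)) / 2 = s"
      by (simp_all add: s_def field_simps)
    have e5: "1 + (1 / a) * (a * (u \<bullet> u)) = 1 + u \<bullet> u"
      using a by simp
    show ?thesis
      unfolding tstd_density_def Ci_def[symmetric] quad a_def[symmetric] e1 e2 e3 e4 e5 J_def student_mass_def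
      using a by (simp add: exp_minus field_simps)
  qed
  have J: "J \<noteq> 0"
  proof -
    have "Gamma s > 0" "Gamma (s - real CARD('n) / 2) > 0"
      using s s0 by (simp_all add: Gamma_real_pos)
    then show ?thesis by (simp add: J_def student_mass_def)
  qed
  have cont: "continuous_on UNIV (\<lambda>z. tstd_density \<nu> C z *\<^sub>R outer (score z) (score z))"
  proof -
    have q0: "z \<bullet> (Ci *v z) \<ge> 0" for z
      unfolding Ci E_def inner_diagonalized by (intro sum_nonneg) auto
    have q: "continuous_on UNIV (\<lambda>z. z \<bullet> (Ci *v z))"
      by (intro continuous_intros linear_continuous_on_compose[OF _ matrix_vector_mul_linear] continuous_on_id)
    have "1 + (1 / (\<nu> - 2)) * (z \<bullet> (Ci *v z)) > 0" for z
      using q0[of z] nu by (intro add_pos_nonneg mult_nonneg_nonneg) auto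
    then have 1: "continuous_on UNIV (tstd_density \<nu> C)"
      unfolding tstd_density_def Ci_def[symmetric]
      by (intro continuous_intros q) (auto simp: less_imp_neq[symmetric])
    have "\<nu> - 2 + z \<bullet> (Ci *v z) \<noteq> 0" for z
      using q0[of z] nu by linarith
    then have 2: "continuous_on UNIV score"
      unfolding score_def W_def
      by (intro continuous_intros linear_continuous_on_compose[OF _ matrix_vector_mul_linear] q
          linear_continuous_on_compose[OF _ bounded_linear.linear[OF bounded_linear_vecm]] continuous_on_outer) auto
    show ?thesis
      by (intro continuous_intros continuous_on_outer 1 2)
  qed
  have "has_bochner_integral lborel
      (\<lambda>u. ((1 + u \<bullet> u) powr (- s)) *\<^sub>R outer (vecm (Y u)) (vecm (Y u)))
      (J *\<^sub>R ((s / (s + 1)) *\<^sub>R (mat 1 + commat) + (s / (s + 1) - 1) *\<^sub>R outer (vecm (mat 1)) (vecm (mat 1))))"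
    unfolding Y_def J_def by (rule student_information[OF s])
  also have "s / (s + 1) = \<phi>"
    using s0 by (simp add: s_def \<phi>_def field_simps)
  finally have "has_bochner_integral lborel
      (\<lambda>u. ((1 / J) * (1/4)) *\<^sub>R ((B ** kron R R) ** (((1 + u \<bullet> u) powr (- s)) *\<^sub>R outer (vecm (Y u)) (vecm (Y u))) ** transpose (B ** kron R R)))
      (((1 / J) * (1/4)) *\<^sub>R ((B ** kron R R) ** (J *\<^sub>R (\<phi> *\<^sub>R (mat 1 + commat) + (\<phi> - 1) *\<^sub>R outer (vecm (mat 1)) (vecm (mat 1)))) ** transpose (B ** kron R R)))"
    by (intro has_bochner_integral_scaleR_right has_bochner_integral_bounded_linear[OF bounded_linear_matrix_sandwich])
  moreover have "((1 / J) * (1/4)) *\<^sub>R ((B ** kron R R) ** (((1 + u \<bullet> u) powr (- s)) *\<^sub>R outer (vecm (Y u)) (vecm (Y u))) ** transpose (B ** kron R R)) =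
      (\<Prod>i\<in>UNIV. \<bar>c $ i\<bar>) *\<^sub>R (tstd_density \<nu> C ((Q ** mdiag c) *v u) *\<^sub>R
        outer (score ((Q ** mdiag c) *v u)) (score ((Q ** mdiag c) *v u)))" for u
    unfolding score_u outer_scaleR scaleR_scaleR mult.assoc[symmetric] dens
    by (simp add: outer_matrix_mult matrix_mult.scaleR_left matrix_mult.scaleR_right)
  moreover have "((1 / J) * (1/4)) *\<^sub>R ((B ** kron R R) ** (J *\<^sub>R (\<phi> *\<^sub>R (mat 1 + commat) + (\<phi> - 1) *\<^sub>R outer (vecm (mat 1)) (vecm (mat 1)))) ** transpose (B ** kron R R)) =
      (1/4) *\<^sub>R (B ** (\<phi> *\<^sub>R (kron Ci Ci ** (mat 1 + commat)) + (\<phi> - 1) *\<^sub>R outer (vecm Ci) (vecm Ci)) ** transpose B)"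
  proof -
    \<comment> \<open>Congruence by \<open>kron R R\<close> turns I, the commutation matrix and
      vec(I) into their counterparts for C^-1, by R R' = C^-1.\<close>
    have k1: "kron R R ** transpose (kron R R) = kron Ci Ci"
      by (simp add: transpose_kron kron_mult RR)
    have k2: "kron R R ** commat ** transpose (kron R R) = kron Ci Ci ** commat"
      by (simp add: kron_commat RR)
    have k3: "kron R R ** outer (vecm (mat 1)) (vecm (mat 1)) ** transpose (kron R R) = outer (vecm Ci) (vecm Ci)"
      by (simp add: outer_matrix_mult[symmetric] kron_vecm RR)
    have "kron R R ** (\<phi> *\<^sub>R (mat 1 + commat) + (\<phi> - 1) *\<^sub>R outer (vecm (mat 1)) (vecm (mat 1))) ** transpose (kron R R) =
        \<phi> *\<^sub>R (kron R R ** transpose (kron R R) + kron R R ** commat ** transpose (kron R R)) +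
        (\<phi> - 1) *\<^sub>R (kron R R ** outer (vecm (mat 1)) (vecm (mat 1)) ** transpose (kron R R))"
      by (simp add: matrix_mult.add_left matrix_mult.add_right matrix_mult.scaleR_left matrix_mult.scaleR_right)
    also have "\<dots> = \<phi> *\<^sub>R (kron Ci Ci ** (mat 1 + commat)) + (\<phi> - 1) *\<^sub>R outer (vecm Ci) (vecm Ci)"
      unfolding k1 k2 k3 by (simp add: matrix_mult.add_right)
    finally have "B ** (kron R R ** (\<phi> *\<^sub>R (mat 1 + commat) + (\<phi> - 1) *\<^sub>R outer (vecm (mat 1)) (vecm (mat 1))) ** transpose (kron R R)) ** transpose B =
      B ** (\<phi> *\<^sub>R (kron Ci Ci ** (mat 1 + commat)) + (\<phi> - 1) *\<^sub>R outer (vecm Ci) (vecm Ci)) ** transpose B"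
      by simp
    then show ?thesis
      using J by (simp add: matrix_transpose_mul matrix_mul_assoc matrix_mult.scaleR_left matrix_mult.scaleR_right)
  qed
  ultimately have "has_bochner_integral lborel
      (\<lambda>u. (\<Prod>i\<in>UNIV. \<bar>c $ i\<bar>) *\<^sub>R (tstd_density \<nu> C ((Q ** mdiag c) *v u) *\<^sub>R
        outer (score ((Q ** mdiag c) *v u)) (score ((Q ** mdiag c) *v u))))
      ((1/4) *\<^sub>R (B ** (\<phi> *\<^sub>R (kron Ci Ci ** (mat 1 + commat)) + (\<phi> - 1) *\<^sub>R outer (vecm Ci) (vecm Ci)) ** transpose B))"
    by (simp only:)
  moreover have "c $ i \<noteq> 0" for i using a by (simp add: c_def)
  ultimately show ?thesis
    by (intro has_bochner_integral_lborel_linear[OF borel_measurable_continuous_onI[OF cont] Q, of c])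
qed

text \<open>Since \<open>matrix_inv\<close> is total, invertibility is asserted separately to give
  the formula for M its meaning. The expectation is a Bochner integral against the density, so its
  existence is part of the claim.\<close>

theorem theorem1:
  fixes p :: "'d::{finite,linorder} \<Rightarrow> ('n::{finite,linorder} \<times> 'n)"
    and \<nu> :: real and \<gamma> :: "(real, 'd) vec"
    and Q :: "((real, 'n) vec, 'n) vec" and lam :: "(real, 'n) vec"
  assumes n2: "CARD('n) \<ge> 2"
    and nu: "\<nu> > 2"
    and p: "vecl_index p"
    and Q: "orthogonal_matrix Q"
    and eig: "mlog (corr_of p \<gamma>) = Q ** mdiag lam ** transpose Q"
  shows
    "let C = corr_of p \<gamma>;
         Ci = matrix_inv C;
         CiK = kron Ci Ci;
         Gm = kron Q Q ** Xi lam ** transpose (kron Q Q);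
         ELU = El p + Eu p;
         M = transpose ELU ** El p
             ** (mat 1 - Gm ** transpose Ed ** matrix_inv (Ed ** Gm ** transpose Ed) ** Ed)
             ** Gm ** transpose ELU;
         W = (\<lambda>z.  (\<nu> + real CARD('n)) / (\<nu> - 2 + z \<bullet> (Ci *v z)));
         \<phi> = (\<nu> + real CARD('n)) / (\<nu> + real CARD('n) + 2);
         score = (\<lambda>z.  (1/2) *\<^sub>R (transpose M ** CiK
                    *v (W z *\<^sub>R vecm (outer z z) - vecm C)));
         Hn = mat 1 + commat
     in ((\<lambda>A. vecm (mexp A)) has_derivative (\<lambda>H. Gm *v vecm H)) (at (mlog C))
      \<and> invertible (Ed ** Gm ** transpose Ed)
      \<and> ((\<lambda>g. vecm (corr_of p g)) has_derivative (\<lambda>h. M *v h)) (at \<gamma>)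
      \<and> (\<forall>z. ((\<lambda>g. ln (tstd_density \<nu> (corr_of p g) z)) has_derivative (\<lambda>h. score z \<bullet> h)) (at \<gamma>))
      \<and> has_bochner_integral lborel (\<lambda>z. tstd_density \<nu> C z *\<^sub>R outer (score z) (score z))
          ((1/4) *\<^sub>R (transpose M ** (\<phi> *\<^sub>R (CiK ** Hn)
              + (\<phi> - 1) *\<^sub>R outer (vecm Ci) (vecm Ci)) ** M))"
proof -
  define C where "C = corr_of p \<gamma>"
  define Ci where "Ci = matrix_inv C"
  define Gm where "Gm = kron Q Q ** Xi lam ** transpose (kron Q Q)"
  define M where "M = transpose (El p + Eu p) ** El p
             ** (mat 1 - Gm ** transpose Ed ** matrix_inv (Ed ** Gm ** transpose Ed) ** Ed)
             ** Gm ** transpose (El p + Eu p)"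
  define W where "W = (\<lambda>z.  (\<nu> + real CARD('n)) / (\<nu> - 2 + z \<bullet> (Ci *v z)))"
  define \<phi> where "\<phi> = (\<nu> + real CARD('n)) / (\<nu> + real CARD('n) + 2)"
  define score where "score = (\<lambda>z.  (1/2) *\<^sub>R (transpose M ** kron Ci Ci
                    *v (W z *\<^sub>R vecm (outer z z) - vecm C)))"
  let ?A = "\<lambda>g. mlog (corr_of p g)"
  have C: "C = mexp (Q ** mdiag lam ** transpose Q)"
    using mexp_mlog_corr_of[OF p, of \<gamma>] by (simp add: C_def eig)
  have dexp_der: "(mexp has_derivative dexp Q lam) (at (?A \<gamma>))"
    unfolding eig by (rule has_derivative_mexp[OF Q])
  have 1: "((\<lambda>A. vecm (mexp A)) has_derivative (\<lambda>H. Gm *v vecm H)) (at (mlog C))"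
    using bounded_linear.has_derivative[OF bounded_linear_vecm dexp_der]
    by (simp add: Gm_def kron_Xi_vecm C_def)
  have 2: "invertible (Ed ** Gm ** transpose Ed)"
    unfolding Gm_def by (rule invertible_Ed_dexp[OF Q])
  obtain K where K: "(?A has_derivative K) (at \<gamma>)" and KM: "\<And>h. vecm (dexp Q lam (K h)) = M *v h"
    using has_derivative_mlog_corr_of[OF p Q eig] unfolding M_def Gm_def by metis
  have 3: "((\<lambda>g. vecm (corr_of p g)) has_derivative (\<lambda>h. M *v h)) (at \<gamma>)"
    using bounded_linear.has_derivative[OF bounded_linear_vecm has_derivative_compose[OF K dexp_der]]
    by (simp add: KM mexp_mlog_corr_of[OF p])
  have 4: "((\<lambda>g. ln (tstd_density \<nu> (corr_of p g) z)) has_derivative (\<lambda>h. score z \<bullet> h)) (at \<gamma>)" for z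
  proof -
    \<comment> \<open>Moving M' across the inner product turns the derivative along M h into a
      gradient.\<close>
    have "score z \<bullet> h = (1/2) * ((kron Ci Ci *v (W z *\<^sub>R vecm (outer z z) - vecm C)) \<bullet> (M *v h))" for h
      unfolding score_def matrix_vector_mul_assoc[symmetric]
      by (simp add: dot_lmul_matrix transpose_matrix_vector)
    then show ?thesis
      using has_derivative_ln_tstd_density[OF nu transpose_mlog_corr_of[OF p] K Q eig, of z]
      by (simp only: mexp_mlog_corr_of[OF p] KM W_def Ci_def C_def)
  qed
  have 5: "has_bochner_integral lborel (\<lambda>z. tstd_density \<nu> C z *\<^sub>R outer (score z) (score z))
          ((1/4) *\<^sub>R (transpose M ** (\<phi> *\<^sub>R (kron Ci Ci ** (mat 1 + commat))
              + (\<phi> - 1) *\<^sub>R outer (vecm Ci) (vecm Ci)) ** M))"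
    using tstd_information[OF nu Q, of lam "transpose M"]
    by (simp only: C[symmetric] Ci_def[symmetric] \<phi>_def[symmetric] transpose_transpose score_def W_def)
  show ?thesis
    unfolding Let_def C_def[symmetric] Ci_def[symmetric] Gm_def[symmetric] M_def[symmetric] \<phi>_def[symmetric]
    using 1 2 3 4 5 unfolding score_def W_def by blast
qed

end
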